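(* Let $\{w_k=(x_k,y_k,\lambda_k)\}$ be an infinite sequence generated by the PFD-SQO algorithm described in the context. Suppose that: (1) there is a constant $\eta>0$ such that $\mathcal H_k^u\succeq \eta I_{n_1+n_2}$ and $\hat{\mathcal H}_k^u\succeq \eta I_{n_1+n_2}$ for all $k=0,1,2,\dots$; moreover, whenever a subsequence $\{w_k\}_{k\in K}$ is bounded, the corresponding matrix subsequences $\{\mathcal H_k^u\}_{k\in K}$ and $\{\hat{\mathcal H}_k^u\}_{k\in K}$ are bounded; (2) for every accumulation point $(x_*,y_*,\lambda_* )$ of $\{w_k\}$, the matrix $\mathcal B_{(x_*,y_* )}=\begin{pmatrix}E_{S_{u_*}}&F_{S_{u_*}}\\ C_{I_{x_*}}&0\\ 0&D_{J_{y_*}}\end{pmatrix}$, with $u_*=(x_*,y_* )$, has full row rank. Then for every accumulation point $w_*=(x_*,y_*,\lambda_* )$ of $\{w_k\}$ there exist an infinite index set $K$ and vectors $\mu_*,\alpha_*^x,\gamma_*^x,\alpha_*^y,\gamma_*^y$ such that $$(\mu_k^x,\mu_k^y,\alpha_k^x,\gamma_k^x,\alpha_k^y,\gamma_k^y)\to(\mu_*,\mu_*,\alpha_*^x,\gamma_*^x,\alpha_*^y,\gamma_*^y)\quad\text{as } k\to\infty,\ k\in K,$$ and $(w_*,\mu_*,\alpha_*^x,\gamma_*^x,\alpha_*^y,\gamma_*^y)$ is a primal-dual KKT solution of problem (P).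
   Context: **Problem (P).** Minimize $\Phi(x,y):=f(x)+\theta(y)$ subject to $Ax+By-b=0$, $Ex+Fy-d\le 0$, $x\in\mathcal X:=\{x\in\mathbb R^{n_1}: l\le Cx\le v\}$, $y\in\mathcal Y:=\{y\in\mathbb R^{n_2}: s\le Dy\le r\}$. Here $f:\mathbb R^{n_1}\to\mathbb R$, $\theta:\mathbb R^{n_2}\to\mathbb R$ are continuously differentiable; $A\in\mathbb R^{m_1\times n_1}$, $B\in\mathbb R^{m_1\times n_2}$, $b\in\mathbb R^{m_1}$, $E\in\mathbb R^{m_2\times n_1}$, $F\in\mathbb R^{m_2\times n_2}$, $d\in\mathbb R^{m_2}$, $C\in\mathbb R^{l_1\times n_1}$, $D\in\mathbb R^{l_2\times n_2}$; $l,s$ have entries in $\mathbb R\cup\{-\infty\}$, $v,r$ have entries in $\mathbb R\cup\{+\infty\}$, $l<v$, $s<r$ componentwise. Write $u=(x,y)$, $w=(x,y,\lambda)$, $\|z\|_H^2=z^\top Hz$, and $\mathcal F_+:=\{(x,y)\in\mathcal X\times\mathcal Y: Ex+Fy-d\le0\}$. For vectors, $0\le p\perp q\ge0$ means $p\ge0$, $q\ge0$, $p^\top q=0$; products with $\pm\infty$ follow the convention $a\times(\pm\infty)=0\Leftrightarrow a=0$, so the multiplier of an infinite bound is $0$. **Primal-dual KKT solution.** $(x,y,\lambda,\mu,\alpha^x,\gamma^x,\alpha^y,\gamma^y)$ is a primal-dual KKT solution of (P) if $\nabla f(x)-A^\top\lambda+E^\top\mu+C^\top(\gamma^x-\alpha^x)=0$,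 $\nabla\theta(y)-B^\top\lambda+F^\top\mu+D^\top(\gamma^y-\alpha^y)=0$, $Ax+By-b=0$, $0\le\mu\perp(d-Ex-Fy)\ge0$, $0\le\alpha^x\perp(Cx-l)\ge0$, $0\le\gamma^x\perp(v-Cx)\ge0$, $0\le\alpha^y\perp(Dy-s)\ge0$, $0\le\gamma^y\perp(r-Dy)\ge0$. **Augmented Lagrangian.** $\mathcal L_\beta(x,y,\lambda)=f(x)+\theta(y)-\lambda^\top(Ax+By-b)+\frac\beta2\|Ax+By-b\|^2$. **PFD-SQO algorithm.** Parameters: $\rho,\sigma\in(0,1)$, $\tau_1,\tau_2>0$, $c\in[0,1]$, $\beta,\xi>0$, $M,M_1>0$, $M_2\ge0$. Start: $u_0=(x_0,y_0)\in\mathcal F_+$, $\lambda_0\in\mathbb R^{m_1}$, symmetric positive definite $H_0^x,H_0^y$. At iteration $k$, given $u_k=(x_k,y_k)$, $\lambda_k$ and symmetric $H_k^x,H_k^y$, put $h_k=Ex_k+Fy_k-d$, $\mathcal H_k^x=H_k^x+\beta A^\top A$, $\mathcal H_k^y=H_k^y+\beta B^\top B$, $\mathcal H_k^u=\mathrm{diag}(\mathcal H_k^x,\mathcal H_k^y)$, $\hat{\mathcal H}_k^u=\mathrm{diag}(H_k^x,H_k^y)+\beta(A\ B)^\top(A\ B)$; it is required throughout that $\mathcal H_k^x$, $\mathcal H_k^y$, $\hat{\mathcal H}_k^u$ are positive definite. Step 1. Let $\tilde x_{k+1}$ be the minimizer of $[\nabla f(x_k)-A^\top(\lambda_k-\beta(Ax_k+By_k-b))]^\top(x-x_k)+\frac12\|x-x_k\|^2_{\mathcal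 H_k^x}$ subject to $Ex+Fy_k-d\le\frac c2h_k$, $l\le Cx\le v$, with KKT multipliers $\mu_k^x,\alpha_k^x,\gamma_k^x\ge 0$ for the constraints $Ex+Fy_k-d\le\frac c2h_k$, $Cx\ge l$, $Cx\le v$, respectively. Let $\tilde y_{k+1}$ be the minimizer of $[\nabla\theta(y_k)-B^\top(\lambda_k-\beta(Ax_k+By_k-b))]^\top(y-y_k)+\frac12\|y-y_k\|^2_{\mathcal H_k^y}$ subject to $Ex_k+Fy-d\le\frac c2h_k$, $s\le Dy\le r$, with KKT multipliers $\mu_k^y,\alpha_k^y,\gamma_k^y\ge0$ for $Ex_k+Fy-d\le\frac c2h_k$, $Dy\ge s$, $Dy\le r$. Step 2. Put $d_k^x=\tilde x_{k+1}-x_k$, $d_k^y=\tilde y_{k+1}-y_k$, $d_k^u=(d_k^x,d_k^y)$. If $\min\{\|\mu_k^x\|,\|\mu_k^y\|\}\le M$ and $\|\mu_k^x-\mu_k^y\|\le M_1(\|d_k^u\|^{\tau_1}+M_2\|Ax_k+By_k-b\|^{\tau_2})$, set $\tilde{\mathcal H}_k^u=\mathcal H_k^u$, $c_{\max}=\frac1{2-c}$ and go to Step 4; otherwise go to Step 3. Step 3. Let $(\tilde x_{k+1},\tilde y_{k+1})$ be the minimizer of $\nabla f(x_k)^\top(x-x_k)+\frac12\|x-x_k\|^2_{H_k^x}+\nabla\theta(y_k)^\top(y-y_k)+\frac12\|y-y_k\|^2_{H_k^y}-\lambda_k^\top(Ax+By-b)+\frac\beta2\|Ax+By-b\|^2$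 subject to $Ex+Fy-d\le0$, $x\in\mathcal X$, $y\in\mathcal Y$, with KKT multipliers $\mu_k,\alpha_k^x,\gamma_k^x,\alpha_k^y,\gamma_k^y\ge0$ for $Ex+Fy-d\le0$, $Cx\ge l$, $Cx\le v$, $Dy\ge s$, $Dy\le r$; set $\mu_k^x=\mu_k^y=\mu_k$. Redefine $d_k^u=(\tilde x_{k+1}-x_k,\tilde y_{k+1}-y_k)$ and set $\tilde{\mathcal H}_k^u=\hat{\mathcal H}_k^u$, $c_{\max}=1$. Step 4. Let $t_k$ be the largest $t\in\{c_{\max}\sigma^i:i=0,1,2,\dots\}$ with $\mathcal L_\beta(u_k+td_k^u,\lambda_k)\le\mathcal L_\beta(w_k)-\rho t\|d_k^u\|^2_{\tilde{\mathcal H}_k^u}$. Step 5. $u_{k+1}=(x_{k+1},y_{k+1})=u_k+t_kd_k^u$, $\lambda_{k+1}=\lambda_k+\xi(Ax_{k+1}+By_{k+1}-b)$, $w_{k+1}=(u_{k+1},\lambda_{k+1})$. If $(x_{k+1}-x_k,y_{k+1}-y_k,Ax_{k+1}+By_{k+1}-b)=0$, stop. Otherwise choose new symmetric $H_{k+1}^x,H_{k+1}^y$ satisfying the positive definiteness requirement and continue with $k+1$. **Active sets.** For $u=(x,y)\in\mathcal F_+$: $I_x=\{i:(Cx)_i=l_i\}\cup\{i:(Cx)_i=v_i\}$, $J_y=\{j:(Dy)_j=s_j\}\cup\{j:(Dy)_j=r_j\}$, $S_u=\{i:(Ex+Fy-d)_i=0\}$; for a matrix $Q$ and index set $S$, $Q_S$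 is the submatrix of rows with indices in $S$. *)

theory Defs
  imports "HOL-Analysis.Analysis"
begin

(* Stacks two vectors; applied to matrices, whose entries are rows, it is vertical concatenation. *)
definition vjoin :: "'c ^ 'a \<Rightarrow> 'c ^ 'b \<Rightarrow> 'c ^ ('a + 'b)" where
  "vjoin p q = (\<chi> i. case i of Inl a \<Rightarrow> p $ a | Inr b \<Rightarrow> q $ b)"

definition hcat :: "real ^ 'a ^ 'm \<Rightarrow> real ^ 'b ^ 'm \<Rightarrow> real ^ ('a + 'b) ^ 'm" where
  "hcat P Q = (\<chi> i. vjoin (P $ i) (Q $ i))"

definition block_diag :: "real ^ 'a ^ 'm \<Rightarrow> real ^ 'b ^ 'n \<Rightarrow> real ^ ('a + 'b) ^ ('m + 'n)" where
  "block_diag P Q = vjoin (hcat P 0) (hcat 0 Q)"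

definition sq_norm :: "real ^ 'n ^ 'n \<Rightarrow> real ^ 'n \<Rightarrow> real" where
  "sq_norm H z = z \<bullet> (H *v z)"

definition pos_def :: "real ^ 'n ^ 'n \<Rightarrow> bool" where
  "pos_def H \<longleftrightarrow> transpose H = H \<and> (\<forall>z. z \<noteq> 0 \<longrightarrow> 0 < sq_norm H z)"

definition pos_semidef :: "real ^ 'n ^ 'n \<Rightarrow> bool" where
  "pos_semidef H \<longleftrightarrow> transpose H = H \<and> (\<forall>z. 0 \<le> sq_norm H z)"

definition loewner_ge :: "real ^ 'n ^ 'n \<Rightarrow> real ^ 'n ^ 'n \<Rightarrow> bool" where
  "loewner_ge G H \<longleftrightarrow> pos_semidef (G - H)"

(* Q_S has full row rank: the rank of the submatrix of rows with indices in S is its number of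
   rows. Since the count is card S, equal rows with different indices violate this. *)
definition full_row_rank_on :: "real ^ 'n ^ 'm \<Rightarrow> 'm set \<Rightarrow> bool" where
  "full_row_rank_on Q S \<longleftrightarrow> dim ((\<lambda>i. row i Q) ` S) = card S"

definition grad :: "('a::real_inner \<Rightarrow> real) \<Rightarrow> 'a \<Rightarrow> 'a" where
  "grad g x = (THE D. GDERIV g x :> D)"

definition continuously_differentiable :: "('a::real_inner \<Rightarrow> real) \<Rightarrow> bool" where
  "continuously_differentiable g \<longleftrightarrow>
     (\<forall>x. GDERIV g x :> grad g x) \<and> continuous_on UNIV (grad g)"

definition ereal_vec :: "real ^ 'n \<Rightarrow> ereal ^ 'n" where
  "ereal_vec z = (\<chi> i. ereal (z $ i))"

(* 0 \<le> p \<perp> q \<ge> 0, with the componentwise order on vectors. On ereal the product satisfies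
   a * \<infinity> = 0 iff a = 0, so an infinite slack forces a zero multiplier. *)
definition compl :: "'a::{comm_monoid_add,times,ord} ^ 'n \<Rightarrow> 'a ^ 'n \<Rightarrow> bool" where
  "compl p q \<longleftrightarrow> 0 \<le> p \<and> 0 \<le> q \<and> (\<Sum>i\<in>UNIV. p $ i * q $ i) = 0"

definition in_box :: "ereal ^ 'k \<Rightarrow> real ^ 'n ^ 'k \<Rightarrow> ereal ^ 'k \<Rightarrow> real ^ 'n \<Rightarrow> bool" where
  "in_box lo G hi z \<longleftrightarrow> lo \<le> ereal_vec (G *v z) \<and> ereal_vec (G *v z) \<le> hi"

(* 0 \<le> \<alpha> \<perp> (G z - lo) \<ge> 0  and  0 \<le> \<gamma> \<perp> (hi - G z) \<ge> 0 *)
definition box_compl ::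
  "ereal ^ 'k \<Rightarrow> real ^ 'n ^ 'k \<Rightarrow> ereal ^ 'k \<Rightarrow> real ^ 'n \<Rightarrow> real ^ 'k \<Rightarrow> real ^ 'k \<Rightarrow> bool" where
  "box_compl lo G hi z \<alpha> \<gamma> \<longleftrightarrow>
     compl (ereal_vec \<alpha>) (ereal_vec (G *v z) - lo) \<and>
     compl (ereal_vec \<gamma>) (hi - ereal_vec (G *v z))"

definition active_rows :: "ereal ^ 'k \<Rightarrow> real ^ 'n ^ 'k \<Rightarrow> ereal ^ 'k \<Rightarrow> real ^ 'n \<Rightarrow> 'k set" where
  "active_rows lo G hi z =
     {i. ereal ((G *v z) $ i) = lo $ i} \<union> {i. ereal ((G *v z) $ i) = hi $ i}"

definition accumulation_point :: "(nat \<Rightarrow> 'a::topological_space) \<Rightarrow> 'a \<Rightarrow> bool" where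
  "accumulation_point w p \<longleftrightarrow> (\<exists>\<kappa>. strict_mono \<kappa> \<and> (w \<circ> \<kappa>) \<longlonglongrightarrow> p)"

(* z minimizes g subject to G z \<le> e, lo \<le> N z \<le> hi, and \<mu>, \<alpha>, \<gamma> are KKT multipliers for it. *)
definition min_with_multipliers ::
  "(real ^ 'n \<Rightarrow> real) \<Rightarrow> real ^ 'n ^ 'm \<Rightarrow> real ^ 'm \<Rightarrow>
   ereal ^ 'k \<Rightarrow> real ^ 'n ^ 'k \<Rightarrow> ereal ^ 'k \<Rightarrow>
   real ^ 'n \<Rightarrow> real ^ 'm \<Rightarrow> real ^ 'k \<Rightarrow> real ^ 'k \<Rightarrow> bool" where
  "min_with_multipliers g G e lo N hi z \<mu> \<alpha> \<gamma> \<longleftrightarrow>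
     is_arg_min g (\<lambda>z. G *v z \<le> e \<and> in_box lo N hi z) z \<and>
     grad g z + transpose G *v \<mu> + transpose N *v (\<gamma> - \<alpha>) = 0 \<and>
     compl \<mu> (e - G *v z) \<and> box_compl lo N hi z \<alpha> \<gamma>"

locale two_block_problem =
  fixes f :: "real ^ 'n1 \<Rightarrow> real" and \<theta> :: "real ^ 'n2 \<Rightarrow> real"
    and A :: "real ^ 'n1 ^ 'm1" and B :: "real ^ 'n2 ^ 'm1" and b :: "real ^ 'm1"
    and E :: "real ^ 'n1 ^ 'm2" and F :: "real ^ 'n2 ^ 'm2" and d :: "real ^ 'm2"
    and C :: "real ^ 'n1 ^ 'l1" and D :: "real ^ 'n2 ^ 'l2"
    and l v :: "ereal ^ 'l1" and s r :: "ereal ^ 'l2"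
  assumes f_C1: "continuously_differentiable f"
    and \<theta>_C1: "continuously_differentiable \<theta>"
    and l_range: "\<And>i. l $ i \<noteq> \<infinity>" and v_range: "\<And>i. v $ i \<noteq> -\<infinity>"
    and s_range: "\<And>j. s $ j \<noteq> \<infinity>" and r_range: "\<And>j. r $ j \<noteq> -\<infinity>"
    and l_less_v: "\<And>i. l $ i < v $ i" and s_less_r: "\<And>j. s $ j < r $ j"
begin

definition res :: "real ^ 'n1 \<Rightarrow> real ^ 'n2 \<Rightarrow> real ^ 'm1" where
  "res x y = A *v x + B *v y - b"

definition hval :: "real ^ 'n1 \<Rightarrow> real ^ 'n2 \<Rightarrow> real ^ 'm2" where
  "hval x y = E *v x + F *v y - d"

definition F_plus :: "((real ^ 'n1) \<times> (real ^ 'n2)) set" where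
  "F_plus = {(x, y). in_box l C v x \<and> in_box s D r y \<and> hval x y \<le> 0}"

definition kkt_solution ::
  "real ^ 'n1 \<Rightarrow> real ^ 'n2 \<Rightarrow> real ^ 'm1 \<Rightarrow> real ^ 'm2 \<Rightarrow>
   real ^ 'l1 \<Rightarrow> real ^ 'l1 \<Rightarrow> real ^ 'l2 \<Rightarrow> real ^ 'l2 \<Rightarrow> bool" where
  "kkt_solution x y lam \<mu> \<alpha>x \<gamma>x \<alpha>y \<gamma>y \<longleftrightarrow>
     grad f x - transpose A *v lam + transpose E *v \<mu> + transpose C *v (\<gamma>x - \<alpha>x) = 0 \<and>
     grad \<theta> y - transpose B *v lam + transpose F *v \<mu> + transpose D *v (\<gamma>y - \<alpha>y) = 0 \<and>
     A *v x + B *v y - b = 0 \<and>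
     compl \<mu> (d - E *v x - F *v y) \<and>
     box_compl l C v x \<alpha>x \<gamma>x \<and> box_compl s D r y \<alpha>y \<gamma>y"

(* Rows (E F), (C 0), (0 D); the active rows below turn it into the matrix of the active
   constraints at (x, y). *)
definition constraint_matrix :: "real ^ ('n1 + 'n2) ^ ('m2 + ('l1 + 'l2))" where
  "constraint_matrix = vjoin (hcat E F) (vjoin (hcat C 0) (hcat 0 D))"

definition active_set :: "real ^ 'n1 \<Rightarrow> real ^ 'n2 \<Rightarrow> ('m2 + ('l1 + 'l2)) set" where
  "active_set x y = {i. hval x y $ i = 0} <+> (active_rows l C v x <+> active_rows s D r y)"

end

locale pfd_sqo = two_block_problem f \<theta> A B b E F d C D l v s r
  for f :: "real ^ 'n1 \<Rightarrow> real" and \<theta> :: "real ^ 'n2 \<Rightarrow> real"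
    and A :: "real ^ 'n1 ^ 'm1" and B :: "real ^ 'n2 ^ 'm1" and b :: "real ^ 'm1"
    and E :: "real ^ 'n1 ^ 'm2" and F :: "real ^ 'n2 ^ 'm2" and d :: "real ^ 'm2"
    and C :: "real ^ 'n1 ^ 'l1" and D :: "real ^ 'n2 ^ 'l2"
    and l v :: "ereal ^ 'l1" and s r :: "ereal ^ 'l2" +
  fixes \<rho> \<sigma> \<tau>1 \<tau>2 c \<beta> \<xi> M M1 M2 :: real
  assumes \<rho>_range: "0 < \<rho>" "\<rho> < 1" and \<sigma>_range: "0 < \<sigma>" "\<sigma> < 1"
    and \<tau>_pos: "0 < \<tau>1" "0 < \<tau>2" and c_range: "0 \<le> c" "c \<le> 1"
    and \<beta>_pos: "0 < \<beta>" and \<xi>_pos: "0 < \<xi>"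
    and M_pos: "0 < M" and M1_pos: "0 < M1" and M2_nonneg: "0 \<le> M2"
begin

definition lagr :: "real ^ 'n1 \<Rightarrow> real ^ 'n2 \<Rightarrow> real ^ 'm1 \<Rightarrow> real" where
  "lagr x y lam = f x + \<theta> y - lam \<bullet> res x y + \<beta> / 2 * (norm (res x y))\<^sup>2"

definition calHx :: "real ^ 'n1 ^ 'n1 \<Rightarrow> real ^ 'n1 ^ 'n1" where
  "calHx Hx = Hx + \<beta> *\<^sub>R (transpose A ** A)"

definition calHy :: "real ^ 'n2 ^ 'n2 \<Rightarrow> real ^ 'n2 ^ 'n2" where
  "calHy Hy = Hy + \<beta> *\<^sub>R (transpose B ** B)"

definition calHu ::
  "real ^ 'n1 ^ 'n1 \<Rightarrow> real ^ 'n2 ^ 'n2 \<Rightarrow> real ^ ('n1 + 'n2) ^ ('n1 + 'n2)" where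
  "calHu Hx Hy = block_diag (calHx Hx) (calHy Hy)"

definition hatHu ::
  "real ^ 'n1 ^ 'n1 \<Rightarrow> real ^ 'n2 ^ 'n2 \<Rightarrow> real ^ ('n1 + 'n2) ^ ('n1 + 'n2)" where
  "hatHu Hx Hy = block_diag Hx Hy + \<beta> *\<^sub>R (transpose (hcat A B) ** hcat A B)"

definition admissible :: "real ^ 'n1 ^ 'n1 \<Rightarrow> real ^ 'n2 ^ 'n2 \<Rightarrow> bool" where
  "admissible Hx Hy \<longleftrightarrow> transpose Hx = Hx \<and> transpose Hy = Hy \<and>
     pos_def (calHx Hx) \<and> pos_def (calHy Hy) \<and> pos_def (hatHu Hx Hy)"

definition step1_x where
  "step1_x x y lam Hx xt \<mu> \<alpha> \<gamma> \<longleftrightarrow>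
     min_with_multipliers
       (\<lambda>z. (grad f x - transpose A *v (lam - \<beta> *\<^sub>R res x y)) \<bullet> (z - x)
              + 1 / 2 * sq_norm (calHx Hx) (z - x))
       E (d - F *v y + (c / 2) *\<^sub>R hval x y) l C v xt \<mu> \<alpha> \<gamma>"

definition step1_y where
  "step1_y x y lam Hy yt \<mu> \<alpha> \<gamma> \<longleftrightarrow>
     min_with_multipliers
       (\<lambda>z. (grad \<theta> y - transpose B *v (lam - \<beta> *\<^sub>R res x y)) \<bullet> (z - y)
              + 1 / 2 * sq_norm (calHy Hy) (z - y))
       F (d - E *v x + (c / 2) *\<^sub>R hval x y) s D r yt \<mu> \<alpha> \<gamma>"

definition step2_test where
  "step2_test x y dx dy \<mu>x \<mu>y \<longleftrightarrow>
     min (norm \<mu>x) (norm \<mu>y) \<le> M \<and>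
     norm (\<mu>x - \<mu>y) \<le> M1 * (norm (dx, dy) powr \<tau>1 + M2 * norm (res x y) powr \<tau>2)"

definition step3_objective ::
  "real ^ 'n1 \<Rightarrow> real ^ 'n2 \<Rightarrow> real ^ 'm1 \<Rightarrow> real ^ 'n1 ^ 'n1 \<Rightarrow> real ^ 'n2 ^ 'n2 \<Rightarrow>
   (real ^ 'n1) \<times> (real ^ 'n2) \<Rightarrow> real" where
  "step3_objective x y lam Hx Hy = (\<lambda>(p, q).
     grad f x \<bullet> (p - x) + 1 / 2 * sq_norm Hx (p - x)
     + grad \<theta> y \<bullet> (q - y) + 1 / 2 * sq_norm Hy (q - y)
     - lam \<bullet> res p q + \<beta> / 2 * (norm (res p q))\<^sup>2)"

definition step3 where
  "step3 x y lam Hx Hy xt yt \<mu> \<alpha>x \<gamma>x \<alpha>y \<gamma>y \<longleftrightarrow>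
     is_arg_min (step3_objective x y lam Hx Hy) (\<lambda>u. u \<in> F_plus) (xt, yt) \<and>
     fst (grad (step3_objective x y lam Hx Hy) (xt, yt))
       + transpose E *v \<mu> + transpose C *v (\<gamma>x - \<alpha>x) = 0 \<and>
     snd (grad (step3_objective x y lam Hx Hy) (xt, yt))
       + transpose F *v \<mu> + transpose D *v (\<gamma>y - \<alpha>y) = 0 \<and>
     compl \<mu> (- hval xt yt) \<and>
     box_compl l C v xt \<alpha>x \<gamma>x \<and> box_compl s D r yt \<alpha>y \<gamma>y"

definition line_search where
  "line_search cmax Hu x y lam dx dy t \<longleftrightarrow>
     is_arg_max (\<lambda>t. t)
       (\<lambda>t. t \<in> {cmax * \<sigma> ^ i | i :: nat. True} \<and>
            lagr (x + t *\<^sub>R dx) (y + t *\<^sub>R dy) lam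
              \<le> lagr x y lam - \<rho> * t * sq_norm Hu (vjoin dx dy)) t"

(* One pass through Steps 1-5, from (x, y, lam) to (x', y', lam'). The multipliers are those in
   force at the end of the iteration: the ones of Step 1 if the test of Step 2 succeeds, otherwise
   the ones of Step 3, with \<mu>x = \<mu>y. *)
definition iteration where
  "iteration x y lam Hx Hy \<mu>x \<mu>y \<alpha>x \<gamma>x \<alpha>y \<gamma>y x' y' lam' \<longleftrightarrow>
     (\<exists>xt1 yt1 \<mu>x1 \<mu>y1 \<alpha>x1 \<gamma>x1 \<alpha>y1 \<gamma>y1 xt yt Hu cmax t.
        step1_x x y lam Hx xt1 \<mu>x1 \<alpha>x1 \<gamma>x1 \<and>
        step1_y x y lam Hy yt1 \<mu>y1 \<alpha>y1 \<gamma>y1 \<and>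
        (if step2_test x y (xt1 - x) (yt1 - y) \<mu>x1 \<mu>y1
         then xt = xt1 \<and> yt = yt1 \<and> \<mu>x = \<mu>x1 \<and> \<mu>y = \<mu>y1 \<and>
              \<alpha>x = \<alpha>x1 \<and> \<gamma>x = \<gamma>x1 \<and> \<alpha>y = \<alpha>y1 \<and> \<gamma>y = \<gamma>y1 \<and>
              Hu = calHu Hx Hy \<and> cmax = 1 / (2 - c)
         else step3 x y lam Hx Hy xt yt \<mu>x \<alpha>x \<gamma>x \<alpha>y \<gamma>y \<and> \<mu>y = \<mu>x \<and>
              Hu = hatHu Hx Hy \<and> cmax = 1) \<and>
        line_search cmax Hu x y lam (xt - x) (yt - y) t \<and>
        x' = x + t *\<^sub>R (xt - x) \<and> y' = y + t *\<^sub>R (yt - y) \<and>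
        lam' = lam + \<xi> *\<^sub>R res x' y')"

(* The run is infinite, so the stopping test of Step 5 fails at every iteration. *)
definition infinite_run ::
  "(nat \<Rightarrow> real ^ 'n1) \<Rightarrow> (nat \<Rightarrow> real ^ 'n2) \<Rightarrow> (nat \<Rightarrow> real ^ 'm1) \<Rightarrow>
   (nat \<Rightarrow> real ^ 'n1 ^ 'n1) \<Rightarrow> (nat \<Rightarrow> real ^ 'n2 ^ 'n2) \<Rightarrow>
   (nat \<Rightarrow> real ^ 'm2) \<Rightarrow> (nat \<Rightarrow> real ^ 'm2) \<Rightarrow>
   (nat \<Rightarrow> real ^ 'l1) \<Rightarrow> (nat \<Rightarrow> real ^ 'l1) \<Rightarrow>
   (nat \<Rightarrow> real ^ 'l2) \<Rightarrow> (nat \<Rightarrow> real ^ 'l2) \<Rightarrow> bool" where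
  "infinite_run x y lam Hx Hy \<mu>x \<mu>y \<alpha>x \<gamma>x \<alpha>y \<gamma>y \<longleftrightarrow>
     (x 0, y 0) \<in> F_plus \<and> pos_def (Hx 0) \<and> pos_def (Hy 0) \<and>
     (\<forall>k. admissible (Hx k) (Hy k) \<and>
          iteration (x k) (y k) (lam k) (Hx k) (Hy k)
            (\<mu>x k) (\<mu>y k) (\<alpha>x k) (\<gamma>x k) (\<alpha>y k) (\<gamma>y k)
            (x (Suc k)) (y (Suc k)) (lam (Suc k)) \<and>
          (x (Suc k) - x k, y (Suc k) - y k, res (x (Suc k)) (y (Suc k))) \<noteq> (0, 0, 0))"

end

end

theory Submission
  imports Defs
begin

text \<open>
  By the sign of the multiplier update, \<open>L(w\<^sub>k)\<close> drops at every iteration by at least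
  \<open>\<rho> \<eta> t\<^sub>k \<parallel>d\<^sub>k\<parallel>\<^sup>2 + \<xi> \<parallel>A x' + B y' - b\<parallel>\<^sup>2\<close>, where \<open>(x', y')\<close> is the next iterate. An accumulation point bounds it from below, so the
  residual and \<open>t\<^sub>k \<parallel>d\<^sub>k\<parallel>\<^sup>2\<close> tend to 0. Along a subsequence converging to the accumulation point the
  directions are bounded, and the line search forces them to 0. Both kinds of subproblem give the
  same perturbed KKT system for \<open>(\<mu>\<^sup>x, \<gamma>\<^sup>x - \<alpha>\<^sup>x, \<gamma>\<^sup>y - \<alpha>\<^sup>y)\<close>, with an error that vanishes because
  \<open>\<mu>\<^sup>x - \<mu>\<^sup>y\<close> and \<open>d\<^sub>k\<close> do. The multipliers are eventually supported on the active set of the limit,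
  where full row rank gives the transposed constraint matrix a linear left inverse; hence they converge.
\<close>

section \<open>Complementarity for box constraints\<close>

text \<open>No multiplier is assumed bounded, and in Step 1 \<open>\<mu>x\<close> and
  \<open>\<mu>y\<close> come from two separate problems and may differ. The proof therefore never
  extracts a convergent subsequence of multipliers: it reads stationarity as a linear system with a
  fixed matrix. Using \<open>\<mu>x\<close> in both blocks of that system costs the error
  \<open>transpose F *v (\<mu>x - \<mu>y)\<close>, which the test of Step 2 controls. Only the
  differences \<open>\<gamma> - \<alpha>\<close> enter the system. Since \<open>l < v\<close> and
  \<open>s < r\<close>, opposite bounds are never active together, so \<open>\<alpha>\<close> and
  \<open>\<gamma>\<close> are the negative and positive parts of their difference and inherit its
  limit. The two kinds of steps are merged before any limit is taken, so a subsequence may mix them.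
  Their first trial sizes, \<open>1 / (2 - c)\<close> and 1, both lie between 1/2 and 1. The upper
  bound keeps the iterates in the boxes by convexity; the lower bound ensures that a step size
  tending to 0 eventually has a rejected predecessor.\<close>

lemma compl_real_iff:
  fixes p q :: "real ^ 'n"
  shows "compl p q \<longleftrightarrow> (\<forall>i. 0 \<le> p $ i \<and> 0 \<le> q $ i \<and> (p $ i = 0 \<or> q $ i = 0))"
  unfolding compl_def less_eq_vec_def
  by (auto simp: sum_nonneg_eq_0_iff)

lemma compl_ereal_iff:
  fixes p q :: "ereal ^ 'n"
  shows "compl p q \<longleftrightarrow> (\<forall>i. 0 \<le> p $ i \<and> 0 \<le> q $ i \<and> (p $ i = 0 \<or> q $ i = 0))"
  unfolding compl_def less_eq_vec_def
  by (auto simp: sum_nonneg_eq_0_iff)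

text \<open>An infinite bound never equals a real value, so the last two disjunctions force its
  multiplier to be 0. The convention for infinite bounds is absorbed here, and later arguments treat
  finite and infinite bounds alike.\<close>

lemma box_compl_iff:
  assumes lo: "\<And>i. lo $ i \<noteq> \<infinity>" and hi: "\<And>i. hi $ i \<noteq> -\<infinity>"
  shows "box_compl lo G hi z \<alpha> \<gamma> \<longleftrightarrow>
    (\<forall>i. 0 \<le> \<alpha> $ i \<and> 0 \<le> \<gamma> $ i \<and>
         lo $ i \<le> ereal ((G *v z) $ i) \<and> ereal ((G *v z) $ i) \<le> hi $ i \<and>
         (\<alpha> $ i = 0 \<or> ereal ((G *v z) $ i) = lo $ i) \<and>
         (\<gamma> $ i = 0 \<or> ereal ((G *v z) $ i) = hi $ i))"
proof -
  have *: "(0 \<le> ereal g - lo $ i \<longleftrightarrow> lo $ i \<le> ereal g) \<and> (ereal g - lo $ i = 0 \<longleftrightarrow> ereal g = lo $ i) \<and>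
     (0 \<le> hi $ i - ereal g \<longleftrightarrow> ereal g \<le> hi $ i) \<and> (hi $ i - ereal g = 0 \<longleftrightarrow> ereal g = hi $ i)" for g i
    using lo[of i] hi[of i] by (cases "lo $ i"; cases "hi $ i") auto
  show ?thesis
    unfolding box_compl_def compl_ereal_iff by (auto simp: ereal_vec_def *)
qed

text \<open>Since the lower bound is strictly below the upper one, at most one of them is active in
  each component, so one of the two multipliers vanishes there. Stationarity only sees the
  difference; this recovers both multipliers from it by a continuous map.\<close>

lemma box_compl_pos_parts:
  assumes "\<And>i. lo $ i \<noteq> \<infinity>" "\<And>i. hi $ i \<noteq> -\<infinity>" "\<And>i. lo $ i < hi $ i"
    and "box_compl lo G hi z \<alpha> \<gamma>"
  shows "\<alpha> = (\<chi> i. max 0 (- (\<gamma> - \<alpha>) $ i))" "\<gamma> = (\<chi> i. max 0 ((\<gamma> - \<alpha>) $ i))"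
proof -
  have "0 \<le> \<alpha> $ i \<and> 0 \<le> \<gamma> $ i \<and> (\<alpha> $ i = 0 \<or> \<gamma> $ i = 0)" for i
    using assms(4) assms(3)[of i] by (auto simp: box_compl_iff[OF assms(1,2)])
  then show "\<alpha> = (\<chi> i. max 0 (- (\<gamma> - \<alpha>) $ i))" "\<gamma> = (\<chi> i. max 0 ((\<gamma> - \<alpha>) $ i))"
    by (simp_all add: vec_eq_iff) (metis add.inverse_neutral diff_0 diff_0_right max.absorb1 max.absorb2 neg_le_0_iff_le)+
qed

text \<open>A normal cone inequality: where \<open>\<alpha>\<close> is nonzero, \<open>z\<close>
  sits at the lower bound and no feasible \<open>w\<close> can be below it; symmetrically for
  \<open>\<gamma>\<close>. With \<open>w\<close> the current iterate it fixes the sign of the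
  multiplier terms in the descent estimate.\<close>

lemma box_compl_inner_nonneg:
  assumes "\<And>i. lo $ i \<noteq> \<infinity>" "\<And>i. hi $ i \<noteq> -\<infinity>"
    and bc: "box_compl lo G hi z \<alpha> \<gamma>" and w: "in_box lo G hi w"
  shows "0 \<le> (\<gamma> - \<alpha>) \<bullet> (G *v (z - w))"
proof -
  have "0 \<le> (\<gamma> - \<alpha>) $ i * (G *v (z - w)) $ i" for i
  proof -
    have w': "lo $ i \<le> ereal ((G *v w) $ i)" "ereal ((G *v w) $ i) \<le> hi $ i"
      using w by (auto simp: in_box_def less_eq_vec_def ereal_vec_def)
    have bc': "0 \<le> \<alpha> $ i" "0 \<le> \<gamma> $ i" "(\<alpha> $ i = 0 \<or> ereal ((G *v z) $ i) = lo $ i)"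
      "(\<gamma> $ i = 0 \<or> ereal ((G *v z) $ i) = hi $ i)"
      using bc by (auto simp: box_compl_iff[OF assms(1,2)])
    have "\<alpha> $ i = 0 \<or> (G *v z) $ i \<le> (G *v w) $ i" "\<gamma> $ i = 0 \<or> (G *v w) $ i \<le> (G *v z) $ i"
      using bc'(3,4) w' by (metis ereal_less_eq(3))+
    then have "\<alpha> $ i * (G *v (z - w)) $ i \<le> 0" "0 \<le> \<gamma> $ i * (G *v (z - w)) $ i"
      using bc'(1,2) by (auto simp: matrix_vector_mult_diff_distrib mult_nonneg_nonpos)
    then show ?thesis by (simp add: algebra_simps)
  qed
  then show ?thesis unfolding inner_vec_def by (auto intro!: sum_nonneg)
qed

lemma in_box_convex:
  assumes "in_box lo G hi z" "in_box lo G hi w" "0 \<le> t" "t \<le> 1"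
  shows "in_box lo G hi (z + t *\<^sub>R (w - z))"
proof -
  have "lo $ i \<le> ereal ((G *v (z + t *\<^sub>R (w - z))) $ i) \<and> ereal ((G *v (z + t *\<^sub>R (w - z))) $ i) \<le> hi $ i" for i
  proof -
    define p q where "p = (G *v z) $ i" and "q = (G *v w) $ i"
    have pq: "lo $ i \<le> ereal p" "ereal p \<le> hi $ i" "lo $ i \<le> ereal q" "ereal q \<le> hi $ i"
      using assms(1,2) by (auto simp: in_box_def less_eq_vec_def ereal_vec_def p_def q_def)
    have e: "(G *v (z + t *\<^sub>R (w - z))) $ i = p + t * (q - p)"
      by (simp add: p_def q_def matrix_vector_right_distrib matrix_vector_mult_diff_distrib matrix_vector_mult_scaleR)
    \<comment> \<open>Staying between two real numbers is enough for both bounds, and it avoids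
      arithmetic with infinite values.\<close>
    have "min p q \<le> p + t * (q - p)" "p + t * (q - p) \<le> max p q"
    proof -
      have "p + t * (q - p) = (1 - t) * p + t * q" by (simp add: algebra_simps)
      moreover have "(1 - t) * min p q + t * min p q \<le> (1 - t) * p + t * q"
        "(1 - t) * p + t * q \<le> (1 - t) * max p q + t * max p q"
        using assms(3,4) by (auto intro!: add_mono mult_left_mono)
      ultimately show "min p q \<le> p + t * (q - p)" "p + t * (q - p) \<le> max p q"
        by (simp_all add: algebra_simps)
    qed
    then show ?thesis unfolding e using pq
      by (smt (verit) ereal_less_eq(3) max_def min_def order_trans)
  qed
  then show ?thesis by (auto simp: in_box_def less_eq_vec_def ereal_vec_def)
qed

section \<open>Block vectors and matrices\<close>

lemma inner_vjoin [simp]: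
  fixes p p' :: "real ^ 'a" and q q' :: "real ^ 'b"
  shows "vjoin p q \<bullet> vjoin p' q' = p \<bullet> p' + q \<bullet> q'"
  unfolding inner_vec_def vjoin_def
  by (simp add: UNIV_Plus_UNIV[symmetric] sum.Plus del: UNIV_Plus_UNIV)

lemma vjoin_add: "vjoin p q + vjoin p' q' = vjoin (p + p') (q + q')"
  by (simp add: vjoin_def vec_eq_iff split: sum.split)

lemma vjoin_scaleR: "a *\<^sub>R vjoin p q = vjoin (a *\<^sub>R p) (a *\<^sub>R q)"
  by (simp add: vjoin_def vec_eq_iff split: sum.split)

lemma vjoin_eq_iff [simp]: "vjoin p q = vjoin p' q' \<longleftrightarrow> p = p' \<and> q = q'"
  by (auto simp: vjoin_def vec_eq_iff split: sum.splits)

lemma vjoin_eq_0_iff [simp]: "vjoin p q = 0 \<longleftrightarrow> p = 0 \<and> q = 0"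
  by (auto simp: vjoin_def vec_eq_iff split: sum.splits)

lemma vjoin_nth [simp]: "vjoin p q $ Inl i = p $ i" "vjoin p q $ Inr j = q $ j"
  by (simp_all add: vjoin_def)

lemma vjoin_zero [simp]: "vjoin 0 0 = 0"
  by simp

lemma tendsto_vjoin [tendsto_intros]:
  assumes "(p \<longlongrightarrow> p0) G" "(q \<longlongrightarrow> q0) G"
  shows "((\<lambda>k. vjoin (p k) (q k)) \<longlongrightarrow> vjoin p0 q0) G"
  using assms by (intro vec_tendstoI) (auto simp: vjoin_def split: sum.split intro!: tendsto_intros)

text \<open>The test of Step 2 measures the direction as a pair, while the matrices act on the
  stacked vector.\<close>

lemma norm_vjoin: "norm (vjoin p q) = norm (p, q)" for p :: "real ^ 'a" and q :: "real ^ 'b"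
  by (simp add: norm_eq_sqrt_inner)

lemma hcat_mult [simp]: "hcat P Q *v vjoin p q = P *v p + Q *v q"
  by (simp add: vec_eq_iff hcat_def matrix_vector_mul_component)

lemma vjoin_mult [simp]: "vjoin P Q *v z = vjoin (P *v z) (Q *v z)"
  for P :: "real ^ 'n ^ 'a" and Q :: "real ^ 'n ^ 'b"
  by (simp add: vec_eq_iff vjoin_def matrix_vector_mul_component split: sum.split)

lemma block_diag_mult [simp]: "block_diag P Q *v vjoin p q = vjoin (P *v p) (Q *v q)"
  by (simp add: block_diag_def)

lemma inner_transpose_mult: "(transpose P *v u) \<bullet> w = u \<bullet> (P *v w)" for P :: "real ^ 'n ^ 'm"
  by (simp add: dot_lmul_matrix)

lemma inner_mult_transpose: "w \<bullet> (transpose P *v u) = (P *v w) \<bullet> u" for P :: "real ^ 'n ^ 'm"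
  by (metis inner_commute inner_transpose_mult)

lemma transpose_zero_mult: "transpose (0 :: real ^ 'n ^ 'm) *v u = 0"
  by (simp add: vec_eq_iff transpose_def matrix_vector_mult_def)

lemma transpose_hcat_mult:
  "transpose (hcat P Q) *v u = vjoin (transpose P *v u) (transpose Q *v u)"
proof -
  have "(transpose (hcat P Q) *v u) \<bullet> vjoin p q = vjoin (transpose P *v u) (transpose Q *v u) \<bullet> vjoin p q" for p q
    unfolding inner_transpose_mult by (simp add: inner_transpose_mult inner_add_right dot_lmul_matrix)
  moreover have "\<exists>p q. w = vjoin p q" for w :: "real ^ ('a + 'b)"
    by (intro exI[of _ "\<chi> i. w $ Inl i"] exI[of _ "\<chi> i. w $ Inr i"])
      (simp add: vec_eq_iff vjoin_def split: sum.split)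
  ultimately show ?thesis by (metis vector_eq_rdot)
qed

lemma transpose_vjoin_mult:
  fixes P :: "real ^ 'n ^ 'a" and Q :: "real ^ 'n ^ 'b"
  shows "transpose (vjoin P Q) *v vjoin p q = transpose P *v p + transpose Q *v q"
proof -
  have "(transpose (vjoin P Q) *v vjoin p q) \<bullet> w = (transpose P *v p + transpose Q *v q) \<bullet> w" for w
    unfolding inner_add_left inner_transpose_mult by simp
  then show ?thesis by (metis vector_eq_rdot)
qed

lemma full_row_rank_on_inj:
  assumes "full_row_rank_on Q S" and "\<And>i. i \<notin> S \<Longrightarrow> m $ i = 0" and "transpose Q *v m = 0"
  shows "m = 0"
proof -
  let ?R = "(\<lambda>i. row i Q) ` S"
  have fin: "finite S" by simp
  have d: "dim ?R = card S" using assms(1) by (simp add: full_row_rank_on_def)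
  have "dim ?R \<le> card ?R" by (simp add: dim_le_card')
  \<comment> \<open>The rank is compared with the number of indices. Since it is at most the number
    of distinct rows, equality makes the rows pairwise distinct, and independence of the set of rows
    becomes independence of the indexed family.\<close>
  then have c: "card ?R = card S" using d card_image_le[OF fin, of "\<lambda>i. row i Q"] by linarith
  then have inj: "inj_on (\<lambda>i. row i Q) S" by (simp add: eq_card_imp_inj_on)
  have ind: "independent ?R"
    by (rule card_le_dim_spanning[where V = ?R]) (auto simp: d c span_superset)
  have "(\<Sum>i\<in>S. m $ i *\<^sub>R row i Q) = (\<Sum>i\<in>UNIV. m $ i *\<^sub>R row i Q)"
    by (rule sum.mono_neutral_left) (auto simp: assms(2))
  also have "\<dots> = transpose Q *v m"
    by (simp add: vec_eq_iff matrix_vector_mult_def transpose_def row_def mult.commute)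
  finally have "(\<Sum>i\<in>S. m $ i *\<^sub>R row i Q) = 0" using assms(3) by simp
  then have s: "(\<Sum>r\<in>?R. m $ (inv_into S (\<lambda>i. row i Q) r) *\<^sub>R r) = 0"
    by (subst sum.reindex[OF inj]) (simp cong: sum.cong add: inv_into_f_f[OF inj])
  have "m $ i = 0" if "i \<in> S" for i
    using independentD[OF ind _ subset_refl s, of "row i Q"] that inv_into_f_f[OF inj that] by simp
  then show ?thesis using assms(2) by (auto simp: vec_eq_iff)
qed

section \<open>Gradients of quadratic models and bounds for matrices\<close>

lemma grad_eq: "GDERIV g x :> D \<Longrightarrow> grad g x = D"
  unfolding grad_def
proof (rule the_equality)
  fix D' assume "GDERIV g x :> D" "GDERIV g x :> D'"
  then have "(\<lambda>h. h \<bullet> D') = (\<lambda>h. h \<bullet> D)"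
    unfolding gderiv_def using has_derivative_unique by blast
  then show "D' = D" by (metis vector_eq_ldot)
qed

lemma has_derivative_sq_norm:
  assumes "transpose H = H"
  shows "((\<lambda>z. sq_norm H (z - x)) has_derivative (\<lambda>h. 2 * (h \<bullet> (H *v (z - x))))) (at z)"
proof -
  have "(z - x) \<bullet> (H *v h) = h \<bullet> (H *v (z - x))" for h
    by (metis assms inner_commute inner_transpose_mult)
  then show ?thesis unfolding sq_norm_def
    by (auto intro!: derivative_eq_intros bounded_linear.has_derivative[OF matrix_vector_mul_bounded_linear])
qed

lemma grad_quadratic:
  assumes "transpose H = H"
  shows "grad (\<lambda>z. g \<bullet> (z - x) + 1 / 2 * sq_norm H (z - x)) z = g + H *v (z - x)"
  by (rule grad_eq, unfold gderiv_def)
    (auto intro!: derivative_eq_intros has_derivative_sq_norm[OF assms] simp: inner_add_right inner_commute)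

text \<open>The constant is crude, from summing over the rows. It serves only to show that a bounded
  family of matrices maps a null sequence to a null sequence.\<close>

lemma norm_mult_vec_le:
  fixes P :: "real ^ 'n ^ 'm"
  shows "norm (P *v z) \<le> real CARD('m) * norm P * norm z"
proof -
  have "norm (P *v z) \<le> (\<Sum>i\<in>UNIV. \<bar>(P *v z) $ i\<bar>)" by (rule norm_le_l1_cart)
  also have "\<dots> \<le> (\<Sum>i\<in>(UNIV::'m set). norm P * norm z)"
  proof (rule sum_mono)
    fix i :: 'm
    have "\<bar>(P *v z) $ i\<bar> \<le> norm (P $ i) * norm z"
      by (simp add: matrix_vector_mul_component Cauchy_Schwarz_ineq2)
    also have "\<dots> \<le> norm P * norm z" by (simp add: Finite_Cartesian_Product.norm_nth_le mult_right_mono)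
    finally show "\<bar>(P *v z) $ i\<bar> \<le> norm P * norm z" .
  qed
  finally show ?thesis by simp
qed

lemma loewner_ge_scaled_id: "loewner_ge H (\<eta> *\<^sub>R mat 1) \<Longrightarrow> \<eta> * (norm z)\<^sup>2 \<le> sq_norm H z"
  unfolding loewner_ge_def pos_semidef_def sq_norm_def
  by (simp add: matrix_vector_mult_diff_rdistrib scaleR_matrix_vector_assoc[symmetric] inner_diff_right power2_norm_eq_inner)

section \<open>Limits along subsequences and the descent inequality\<close>

lemma tendsto_along_range:
  assumes "strict_mono (\<kappa> :: nat \<Rightarrow> nat)" and "(\<lambda>n. g (\<kappa> n)) \<longlonglongrightarrow> L"
  shows "(g \<longlongrightarrow> L) (inf sequentially (principal (range \<kappa>)))"
proof (rule topological_tendstoI)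
  fix S assume "open S" "L \<in> S"
  then have "\<forall>\<^sub>F n in sequentially. g (\<kappa> n) \<in> S" using assms(2) topological_tendstoD by blast
  then obtain N where N: "\<And>n. n \<ge> N \<Longrightarrow> g (\<kappa> n) \<in> S" by (auto simp: eventually_sequentially)
  \<comment> \<open>By strict monotonicity, a member of the range that is at least
    \<open>\<kappa> N\<close> has the form \<open>\<kappa> n\<close> with
    \<open>n \<ge> N\<close>.\<close>
  have "k \<in> range \<kappa> \<longrightarrow> g k \<in> S" if "k \<ge> \<kappa> N" for k
    using that N assms(1) by (auto simp: strict_mono_less_eq)
  then show "\<forall>\<^sub>F k in inf sequentially (principal (range \<kappa>)). g k \<in> S"
    unfolding eventually_inf_principal eventually_sequentially by blast
qed

text \<open>A bound that is inactive at the limit is inactive for all late \<open>n\<close>, so its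
  multiplier is 0 from then on. The first claim needs no convergence of the multipliers; it is what
  later makes them converge, and only then does the second claim apply.\<close>

lemma box_compl_limit:
  assumes lo: "\<And>i. lo $ i \<noteq> \<infinity>" and hi: "\<And>i. hi $ i \<noteq> -\<infinity>"
    and bc: "\<And>n. box_compl lo G hi (z n) (\<alpha> n) (\<gamma> n)" and z: "z \<longlonglongrightarrow> zs"
  shows "\<forall>\<^sub>F n in sequentially. \<forall>i. (\<alpha> n $ i = 0 \<or> ereal ((G *v zs) $ i) = lo $ i) \<and>
           (\<gamma> n $ i = 0 \<or> ereal ((G *v zs) $ i) = hi $ i)"
    and "\<alpha> \<longlonglongrightarrow> \<alpha>s \<Longrightarrow> \<gamma> \<longlonglongrightarrow> \<gamma>s \<Longrightarrow> box_compl lo G hi zs \<alpha>s \<gamma>s"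
proof -
  note bc' = bc[unfolded box_compl_iff[OF lo hi]]
  have Gz: "(\<lambda>n. G *v z n) \<longlonglongrightarrow> G *v zs"
    using bounded_linear.tendsto[OF matrix_vector_mul_bounded_linear z] .
  then have lim: "(\<lambda>n. ereal ((G *v z n) $ i)) \<longlonglongrightarrow> ereal ((G *v zs) $ i)" for i
    by (intro tendsto_intros)
  \<comment> \<open>The limit is taken in \<open>ereal\<close>, so that \<open>e\<close> may be an
    infinite bound.\<close>
  have ne: "\<forall>\<^sub>F n in sequentially. e = ereal ((G *v zs) $ i) \<or> ereal ((G *v z n) $ i) \<noteq> e" for e i
    using tendsto_imp_eventually_ne[OF lim[of i], of e] by (cases "e = ereal ((G *v zs) $ i)") auto
  have "\<forall>\<^sub>F n in sequentially. (\<alpha> n $ i = 0 \<or> ereal ((G *v zs) $ i) = lo $ i) \<and>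
           (\<gamma> n $ i = 0 \<or> ereal ((G *v zs) $ i) = hi $ i)" for i
    using ne[of "lo $ i" i] ne[of "hi $ i" i]
  proof eventually_elim
    case (elim n)
    then show ?case using bc'[of n] by metis
  qed
  then show ev: "\<forall>\<^sub>F n in sequentially. \<forall>i. (\<alpha> n $ i = 0 \<or> ereal ((G *v zs) $ i) = lo $ i) \<and>
           (\<gamma> n $ i = 0 \<or> ereal ((G *v zs) $ i) = hi $ i)"
    by (intro eventually_all_finite) auto
  assume a: "\<alpha> \<longlonglongrightarrow> \<alpha>s" and g: "\<gamma> \<longlonglongrightarrow> \<gamma>s"
  have ai: "(\<lambda>n. \<alpha> n $ i) \<longlonglongrightarrow> \<alpha>s $ i" and gi: "(\<lambda>n. \<gamma> n $ i) \<longlonglongrightarrow> \<gamma>s $ i" for i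
    using a g by (auto intro: tendsto_intros)
  have z0: "u $ i = 0 \<or> e = e'"
    if "\<forall>\<^sub>F n in sequentially. w n $ i = 0 \<or> e = e'" and "(\<lambda>n. w n $ i) \<longlonglongrightarrow> u $ i"
    for e e' :: ereal and u and w :: "nat \<Rightarrow> real ^ 'k" and i :: 'k
  proof (cases "e = e'")
    case False
    then have "\<forall>\<^sub>F n in sequentially. w n $ i = 0" using that(1) by simp
    then have "(\<lambda>n. w n $ i) \<longlonglongrightarrow> 0" by (rule tendsto_eventually)
    then show ?thesis using that(2) LIMSEQ_unique by blast
  qed simp
  show "box_compl lo G hi zs \<alpha>s \<gamma>s"
    unfolding box_compl_iff[OF lo hi]
  proof (intro allI conjI)
    fix i
    show "0 \<le> \<alpha>s $ i" by (rule LIMSEQ_le_const[OF ai]) (use bc' in auto)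
    show "0 \<le> \<gamma>s $ i" by (rule LIMSEQ_le_const[OF gi]) (use bc' in auto)
    show "lo $ i \<le> ereal ((G *v zs) $ i)" by (rule LIMSEQ_le_const[OF lim]) (use bc' in auto)
    show "ereal ((G *v zs) $ i) \<le> hi $ i" by (rule LIMSEQ_le_const2[OF lim]) (use bc' in auto)
    show "\<alpha>s $ i = 0 \<or> ereal ((G *v zs) $ i) = lo $ i"
      by (rule z0[OF _ ai]) (use ev in \<open>auto elim: eventually_mono\<close>)
    show "\<gamma>s $ i = 0 \<or> ereal ((G *v zs) $ i) = hi $ i"
      by (rule z0[OF _ gi]) (use ev in \<open>auto elim: eventually_mono\<close>)
  qed
qed

lemma box_compl_support_limit:
  assumes "\<And>i. lo $ i \<noteq> \<infinity>" "\<And>i. hi $ i \<noteq> -\<infinity>"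
    and "\<And>n. box_compl lo G hi (z n) (\<alpha> n) (\<gamma> n)" "z \<longlonglongrightarrow> zs"
  shows "\<forall>\<^sub>F n in sequentially. \<forall>i. i \<notin> active_rows lo G hi zs \<longrightarrow> (\<gamma> n - \<alpha> n) $ i = 0"
  using box_compl_limit(1)[OF assms]
proof eventually_elim
  case (elim n)
  have "(\<gamma> n - \<alpha> n) $ i = 0" if "i \<notin> active_rows lo G hi zs" for i
    using elim[rule_format, of i] that by (auto simp: active_rows_def)
  then show ?case by blast
qed

lemma in_box_of_compl:
  assumes "\<And>i. lo $ i \<noteq> \<infinity>" "\<And>i. hi $ i \<noteq> -\<infinity>" "box_compl lo G hi z \<alpha> \<gamma>"
  shows "in_box lo G hi z"
  using assms(3) by (auto simp: box_compl_iff[OF assms(1,2)] in_box_def less_eq_vec_def ereal_vec_def)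

text \<open>Pair the stationarity equation with \<open>z - x\<close>. Because the current point
  \<open>x\<close> is feasible, complementarity makes both multiplier terms nonnegative, and what
  remains says that the step is a descent direction with slope controlled by the model's own
  curvature.\<close>

lemma min_with_multipliers_quadratic:
  assumes range: "\<And>i. lo $ i \<noteq> \<infinity>" "\<And>i. hi $ i \<noteq> -\<infinity>" and H: "transpose H = H"
    and m: "min_with_multipliers (\<lambda>z. g \<bullet> (z - x) + 1 / 2 * sq_norm H (z - x)) G e lo N hi z \<mu> \<alpha> \<gamma>"
    and x: "G *v x \<le> e" "in_box lo N hi x"
  shows "g + H *v (z - x) + transpose G *v \<mu> + transpose N *v (\<gamma> - \<alpha>) = 0"
    and "g \<bullet> (z - x) \<le> - sq_norm H (z - x)"
proof -
  have bc: "box_compl lo N hi z \<alpha> \<gamma>" and cm: "compl \<mu> (e - G *v z)"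
    using m by (auto simp: min_with_multipliers_def)
  show eq: "g + H *v (z - x) + transpose G *v \<mu> + transpose N *v (\<gamma> - \<alpha>) = 0"
    using m unfolding min_with_multipliers_def grad_quadratic[OF H] by simp
  have "0 \<le> \<mu> $ i * (G *v (z - x)) $ i" for i
  proof -
    have "0 \<le> \<mu> $ i" "\<mu> $ i = 0 \<or> (G *v z) $ i = e $ i" using cm by (auto simp: compl_real_iff)
    moreover have "(G *v x) $ i \<le> e $ i" using x(1) by (auto simp: less_eq_vec_def)
    ultimately show ?thesis by (auto simp: matrix_vector_mult_diff_distrib)
  qed
  then have "0 \<le> \<mu> \<bullet> (G *v (z - x))" unfolding inner_vec_def by (auto intro!: sum_nonneg)
  moreover have "0 \<le> (\<gamma> - \<alpha>) \<bullet> (N *v (z - x))"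
    by (rule box_compl_inner_nonneg[OF range bc x(2)])
  moreover have "g \<bullet> (z - x) + sq_norm H (z - x) + \<mu> \<bullet> (G *v (z - x)) + (\<gamma> - \<alpha>) \<bullet> (N *v (z - x)) = 0"
    using arg_cong[OF eq, of "\<lambda>u. u \<bullet> (z - x)"]
    unfolding inner_add_left inner_transpose_mult sq_norm_def inner_zero_left
    by (simp only: inner_commute)
  ultimately show "g \<bullet> (z - x) \<le> - sq_norm H (z - x)" by linarith
qed

declare transpose_matrix_vector [simp del]

section \<open>One iteration\<close>

context two_block_problem
begin

lemma transpose_constraint_matrix_mult:
  "transpose constraint_matrix *v vjoin p (vjoin q q') =
     vjoin (transpose E *v p + transpose C *v q) (transpose F *v p + transpose D *v q')"
  by (simp add: constraint_matrix_def transpose_vjoin_mult transpose_hcat_mult vjoin_add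
      transpose_zero_mult)

end

context pfd_sqo
begin

text \<open>This is the partial gradient of \<open>lagr\<close> and at the same time the linear
  coefficient of the objective in \<open>step1_x\<close>, so the slopes of the subproblems are
  slopes of the merit function used in the line search.\<close>

definition lagr_grad_x :: "real ^ 'n1 \<Rightarrow> real ^ 'n2 \<Rightarrow> real ^ 'm1 \<Rightarrow> real ^ 'n1" where
  "lagr_grad_x x y lam = grad f x - transpose A *v (lam - \<beta> *\<^sub>R res x y)"

definition lagr_grad_y :: "real ^ 'n1 \<Rightarrow> real ^ 'n2 \<Rightarrow> real ^ 'm1 \<Rightarrow> real ^ 'n2" where
  "lagr_grad_y x y lam = grad \<theta> y - transpose B *v (lam - \<beta> *\<^sub>R res x y)"

lemmas mv_simps = matrix_vector_right_distrib matrix_vector_mult_diff_distrib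
  matrix_vector_mult_scaleR matrix_vector_mult_add_rdistrib

lemma f_derivative: "(f has_derivative (\<lambda>h. h \<bullet> grad f x)) (at x)"
  and \<theta>_derivative: "(\<theta> has_derivative (\<lambda>h. h \<bullet> grad \<theta> y)) (at y)"
  using f_C1 \<theta>_C1 by (auto simp: continuously_differentiable_def gderiv_def)

lemma grad_f_isCont: "isCont (grad f) x" and grad_\<theta>_isCont: "isCont (grad \<theta>) y"
  using f_C1 \<theta>_C1 by (auto simp: continuously_differentiable_def continuous_on_eq_continuous_at)

lemma tendsto_res:
  assumes "(p \<longlongrightarrow> x) G" "(q \<longlongrightarrow> y) G"
  shows "((\<lambda>k. res (p k) (q k)) \<longlongrightarrow> res x y) G"
  unfolding res_def
  by (intro tendsto_intros bounded_linear.tendsto[OF matrix_vector_mul_bounded_linear] assms)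

lemma tendsto_hval:
  assumes "(p \<longlongrightarrow> x) G" "(q \<longlongrightarrow> y) G"
  shows "((\<lambda>k. hval (p k) (q k)) \<longlongrightarrow> hval x y) G"
  unfolding hval_def
  by (intro tendsto_intros bounded_linear.tendsto[OF matrix_vector_mul_bounded_linear] assms)

lemma tendsto_lagr_gradient:
  assumes "(p \<longlongrightarrow> x) G" "(q \<longlongrightarrow> y) G" "(m \<longlongrightarrow> lam) G"
  shows "((\<lambda>k. lagr_grad_x (p k) (q k) (m k)) \<longlongrightarrow> lagr_grad_x x y lam) G"
    and "((\<lambda>k. lagr_grad_y (p k) (q k) (m k)) \<longlongrightarrow> lagr_grad_y x y lam) G"
  unfolding lagr_grad_x_def lagr_grad_y_def
  by (intro tendsto_intros bounded_linear.tendsto[OF matrix_vector_mul_bounded_linear]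
      isCont_tendsto_compose[OF grad_f_isCont] isCont_tendsto_compose[OF grad_\<theta>_isCont] tendsto_res assms)+

lemma tendsto_lagr:
  assumes "(p \<longlongrightarrow> x) G" "(q \<longlongrightarrow> y) G" "(m \<longlongrightarrow> lam) G"
  shows "((\<lambda>k. lagr (p k) (q k) (m k)) \<longlongrightarrow> lagr x y lam) G"
  unfolding lagr_def
  by (intro tendsto_intros isCont_tendsto_compose[OF has_derivative_continuous[OF f_derivative]]
      isCont_tendsto_compose[OF has_derivative_continuous[OF \<theta>_derivative]] tendsto_res assms)

lemma res_shift: "res (x + p) (y + q) = res x y + (A *v p + B *v q)"
  by (simp add: res_def mv_simps)

lemma hval_shift: "hval (x + p) (y + q) = hval x y + (E *v p + F *v q)"
  by (simp add: hval_def mv_simps)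

lemma lagr_line_derivative:
  "((\<lambda>a. lagr (x + a *\<^sub>R p) (y + a *\<^sub>R q) lam) has_real_derivative
      lagr_grad_x (x + a *\<^sub>R p) (y + a *\<^sub>R q) lam \<bullet> p + lagr_grad_y (x + a *\<^sub>R p) (y + a *\<^sub>R q) lam \<bullet> q) (at a)"
proof -
  let ?x = "x + a *\<^sub>R p" and ?y = "y + a *\<^sub>R q" and ?w = "A *v p + B *v q"
  have lx: "((\<lambda>a. x + a *\<^sub>R p) has_derivative (\<lambda>h. h *\<^sub>R p)) (at a)"
    and ly: "((\<lambda>a. y + a *\<^sub>R q) has_derivative (\<lambda>h. h *\<^sub>R q)) (at a)"
    by (auto intro!: derivative_eq_intros)
  have r: "((\<lambda>a. res (x + a *\<^sub>R p) (y + a *\<^sub>R q)) has_derivative (\<lambda>h. h *\<^sub>R ?w)) (at a)"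
    unfolding res_shift by (auto intro!: derivative_eq_intros simp: mv_simps scaleR_add_right)
  have "((\<lambda>a. f (x + a *\<^sub>R p) + \<theta> (y + a *\<^sub>R q) - lam \<bullet> res (x + a *\<^sub>R p) (y + a *\<^sub>R q)
       + \<beta> / 2 * (res (x + a *\<^sub>R p) (y + a *\<^sub>R q) \<bullet> res (x + a *\<^sub>R p) (y + a *\<^sub>R q))) has_derivative
     (\<lambda>h. (h *\<^sub>R p) \<bullet> grad f ?x + (h *\<^sub>R q) \<bullet> grad \<theta> ?y - lam \<bullet> (h *\<^sub>R ?w)
         + \<beta> / 2 * (res ?x ?y \<bullet> (h *\<^sub>R ?w) + (h *\<^sub>R ?w) \<bullet> res ?x ?y))) (at a)"
    by (intro has_derivative_add has_derivative_diff has_derivative_inner_right has_derivative_mult_right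
        has_derivative_inner r has_derivative_compose[OF lx f_derivative] has_derivative_compose[OF ly \<theta>_derivative])
  moreover have "(\<lambda>h. (h *\<^sub>R p) \<bullet> grad f ?x + (h *\<^sub>R q) \<bullet> grad \<theta> ?y - lam \<bullet> (h *\<^sub>R ?w)
         + \<beta> / 2 * (res ?x ?y \<bullet> (h *\<^sub>R ?w) + (h *\<^sub>R ?w) \<bullet> res ?x ?y)) =
      (*) (lagr_grad_x ?x ?y lam \<bullet> p + lagr_grad_y ?x ?y lam \<bullet> q)"
    by (rule ext) (simp add: lagr_grad_x_def lagr_grad_y_def inner_diff_left inner_transpose_mult inner_mult_transpose inner_add_right
        inner_commute algebra_simps)
  ultimately show ?thesis
    unfolding has_field_derivative_def lagr_def power2_norm_eq_inner by simp
qed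

text \<open>What Step 1 (with the test of Step 2) and Step 3 have in common. The two steps put different
  slacks into complementarity with \<open>\<mu>x\<close>; of both it is only kept that \<open>- h\<^sub>i \<le> O(\<parallel>d\<parallel>)\<close> where \<open>\<mu>x\<^sub>i \<noteq> 0\<close>,
  with \<open>2\<close> coming from \<open>1 - c / 2 \<ge> 1 / 2\<close>.\<close>
definition trial_step where
  "trial_step x y lam Hu p q \<mu>x \<mu>y \<alpha>x \<gamma>x \<alpha>y \<gamma>y \<longleftrightarrow>
     Hu *v vjoin p q + vjoin (lagr_grad_x x y lam) (lagr_grad_y x y lam)
       + vjoin (transpose E *v \<mu>x + transpose C *v (\<gamma>x - \<alpha>x))
               (transpose F *v \<mu>y + transpose D *v (\<gamma>y - \<alpha>y)) = 0 \<and>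
     lagr_grad_x x y lam \<bullet> p + lagr_grad_y x y lam \<bullet> q \<le> - sq_norm Hu (vjoin p q) \<and>
     (\<forall>i. 0 \<le> \<mu>x $ i \<and> (\<mu>x $ i = 0 \<or> - hval x y $ i \<le> 2 * (norm (E *v p) + norm (F *v q)))) \<and>
     norm (\<mu>x - \<mu>y) \<le> M1 * (norm (p, q) powr \<tau>1 + M2 * norm (res x y) powr \<tau>2) \<and>
     box_compl l C v (x + p) \<alpha>x \<gamma>x \<and> box_compl s D r (y + q) \<alpha>y \<gamma>y"

text \<open>From \<open>h \<le> 0\<close> and \<open>c / 2 \<le> 1\<close> one gets
  \<open>h \<le> c / 2 * h\<close>, so the current iterate is feasible for both subproblems. In
  terms of the steps the constraints read \<open>E p \<le> - (1 - c / 2) h\<close> and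
  \<open>F q \<le> - (1 - c / 2) h\<close>. Adding them gives the second claim, whose factor
  \<open>2 - c\<close> is the origin of the initial step size \<open>1 / (2 - c)\<close>.\<close>

lemma step1_facts:
  assumes adm: "admissible Hx Hy" and feas: "(x, y) \<in> F_plus"
    and sx: "step1_x x y lam Hx xt \<mu>x \<alpha>x \<gamma>x" and sy: "step1_y x y lam Hy yt \<mu>y \<alpha>y \<gamma>y"
  shows "step2_test x y (xt - x) (yt - y) \<mu>x \<mu>y \<Longrightarrow>
          trial_step x y lam (calHu Hx Hy) (xt - x) (yt - y) \<mu>x \<mu>y \<alpha>x \<gamma>x \<alpha>y \<gamma>y"
    and "E *v (xt - x) + F *v (yt - y) \<le> - (2 - c) *\<^sub>R hval x y"
    and "in_box l C v xt" and "in_box s D r yt"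
proof -
  define p q h where "p = xt - x" and "q = yt - y" and "h = hval x y"
  have h: "h $ i \<le> 0" for i using feas by (auto simp: F_plus_def less_eq_vec_def h_def)
  have hc: "h $ i \<le> c / 2 * h $ i" for i
    using mult_right_mono_neg[OF _ h[of i], of "c / 2" 1] c_range by simp
  have Hs: "transpose (calHx Hx) = calHx Hx" "transpose (calHy Hy) = calHy Hy"
    using adm by (auto simp: admissible_def pos_def_def)
  have slack: "d - F *v y + (c / 2) *\<^sub>R hval x y - E *v xt = - (1 - c / 2) *\<^sub>R h - E *v p"
    "d - E *v x + (c / 2) *\<^sub>R hval x y - F *v yt = - (1 - c / 2) *\<^sub>R h - F *v q"
    by (simp_all add: h_def p_def q_def hval_def mv_simps algebra_simps)
  have fx: "E *v x \<le> d - F *v y + (c / 2) *\<^sub>R hval x y" and fy: "F *v y \<le> d - E *v x + (c / 2) *\<^sub>R hval x y"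
    using hc by (auto simp: less_eq_vec_def hval_def h_def algebra_simps)
  have bx: "in_box l C v x" and by': "in_box s D r y" using feas by (auto simp: F_plus_def)
  have kx: "compl \<mu>x (- (1 - c / 2) *\<^sub>R h - E *v p)" "box_compl l C v xt \<alpha>x \<gamma>x"
    using sx by (auto simp: step1_x_def min_with_multipliers_def slack)
  have ky: "compl \<mu>y (- (1 - c / 2) *\<^sub>R h - F *v q)" "box_compl s D r yt \<alpha>y \<gamma>y"
    using sy by (auto simp: step1_y_def min_with_multipliers_def slack)
  show "in_box l C v xt" by (rule in_box_of_compl[OF l_range v_range kx(2)])
  show "in_box s D r yt" by (rule in_box_of_compl[OF s_range r_range ky(2)])
  show "E *v (xt - x) + F *v (yt - y) \<le> - (2 - c) *\<^sub>R hval x y"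
    unfolding less_eq_vec_def p_def[symmetric] q_def[symmetric] h_def[symmetric]
  proof
    fix i
    have "(E *v p) $ i \<le> - (1 - c / 2) * h $ i" "(F *v q) $ i \<le> - (1 - c / 2) * h $ i"
      using kx(1) ky(1) by (auto simp: compl_real_iff)
    then show "(E *v p + F *v q) $ i \<le> (- (2 - c) *\<^sub>R h) $ i" by (simp add: algebra_simps)
  qed
  note qx = min_with_multipliers_quadratic[OF l_range v_range Hs(1) sx[unfolded step1_x_def] fx bx,
      folded lagr_grad_x_def p_def]
  note qy = min_with_multipliers_quadratic[OF s_range r_range Hs(2) sy[unfolded step1_y_def] fy by',
      folded lagr_grad_y_def q_def]
  assume test: "step2_test x y (xt - x) (yt - y) \<mu>x \<mu>y"
  show "trial_step x y lam (calHu Hx Hy) (xt - x) (yt - y) \<mu>x \<mu>y \<alpha>x \<gamma>x \<alpha>y \<gamma>y"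
    unfolding trial_step_def p_def[symmetric] q_def[symmetric]
  proof (intro conjI allI)
    have "vjoin (lagr_grad_x x y lam + calHx Hx *v p + transpose E *v \<mu>x + transpose C *v (\<gamma>x - \<alpha>x))
        (lagr_grad_y x y lam + calHy Hy *v q + transpose F *v \<mu>y + transpose D *v (\<gamma>y - \<alpha>y)) = 0"
      unfolding qx(1) qy(1) by simp
    then show "calHu Hx Hy *v vjoin p q + vjoin (lagr_grad_x x y lam) (lagr_grad_y x y lam)
       + vjoin (transpose E *v \<mu>x + transpose C *v (\<gamma>x - \<alpha>x))
               (transpose F *v \<mu>y + transpose D *v (\<gamma>y - \<alpha>y)) = 0"
      by (simp add: calHu_def vjoin_add add_ac)
    show "lagr_grad_x x y lam \<bullet> p + lagr_grad_y x y lam \<bullet> q \<le> - sq_norm (calHu Hx Hy) (vjoin p q)"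
      using qx(2) qy(2) by (simp add: sq_norm_def calHu_def)
    show "norm (\<mu>x - \<mu>y) \<le> M1 * (norm (p, q) powr \<tau>1 + M2 * norm (res x y) powr \<tau>2)"
      using test by (simp add: step2_test_def p_def q_def)
    show "box_compl l C v (x + p) \<alpha>x \<gamma>x" "box_compl s D r (y + q) \<alpha>y \<gamma>y"
      using kx ky by (simp_all add: p_def q_def)
    fix i
    show "0 \<le> \<mu>x $ i" using kx by (simp add: compl_real_iff)
    have "\<mu>x $ i = 0 \<or> - (1 - c / 2) * h $ i = (E *v p) $ i" using kx by (auto simp: compl_real_iff)
    moreover have "\<bar>(E *v p) $ i\<bar> \<le> norm (E *v p)" by (rule component_le_norm_cart)
    moreover have "(1 / 2) * (- h $ i) \<le> (1 - c / 2) * (- h $ i)"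
      by (rule mult_right_mono) (use c_range h[of i] in auto)
    ultimately have "- h $ i \<le> 2 * (norm (E *v p) + norm (F *v q))" if "\<mu>x $ i \<noteq> 0"
      using that by (simp add: algebra_simps) (smt (verit) norm_ge_zero)
    then show "\<mu>x $ i = 0 \<or> - hval x y $ i \<le> 2 * (norm (E *v p) + norm (F *v q))"
      unfolding h_def by blast
  qed
qed

text \<open>The residual is affine, so the penalty gradient at the trial point is the one at the
  current point plus a term linear in the step. Together with \<open>hatHu_mult\<close> this puts
  Step 3 in the same form as Step 1: gradient of \<open>lagr\<close> plus a matrix applied to the
  direction, now with \<open>hatHu\<close>.\<close>

lemma grad_step3_objective:
  assumes "transpose Hx = Hx" "transpose Hy = Hy"
  shows "grad (step3_objective x y lam Hx Hy) (x + p, y + q) =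
    (lagr_grad_x x y lam + Hx *v p + \<beta> *\<^sub>R (transpose A *v (A *v p + B *v q)),
     lagr_grad_y x y lam + Hy *v q + \<beta> *\<^sub>R (transpose B *v (A *v p + B *v q)))"
proof (rule grad_eq, unfold gderiv_def)
  let ?w = "(x + p, y + q)" and ?R = "res (x + p) (y + q)"
  have r: "((\<lambda>u. res (fst u) (snd u)) has_derivative (\<lambda>h. A *v fst h + B *v snd h)) (at ?w)"
    unfolding res_def
    by (auto intro!: derivative_eq_intros bounded_linear.has_derivative[OF matrix_vector_mul_bounded_linear])
  have qx: "((\<lambda>u. sq_norm Hx (fst u - x)) has_derivative (\<lambda>h. 2 * (fst h \<bullet> (Hx *v (fst ?w - x))))) (at ?w)"
    by (rule has_derivative_compose[OF has_derivative_fst[OF has_derivative_ident]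
        has_derivative_sq_norm[OF assms(1)]])
  have qy: "((\<lambda>u. sq_norm Hy (snd u - y)) has_derivative (\<lambda>h. 2 * (snd h \<bullet> (Hy *v (snd ?w - y))))) (at ?w)"
    by (rule has_derivative_compose[OF has_derivative_snd[OF has_derivative_ident]
        has_derivative_sq_norm[OF assms(2)]])
  have "((\<lambda>u. grad f x \<bullet> (fst u - x) + 1 / 2 * sq_norm Hx (fst u - x)
       + grad \<theta> y \<bullet> (snd u - y) + 1 / 2 * sq_norm Hy (snd u - y)
       - lam \<bullet> res (fst u) (snd u) + \<beta> / 2 * (res (fst u) (snd u) \<bullet> res (fst u) (snd u))) has_derivative
     (\<lambda>h. grad f x \<bullet> fst h + 1 / 2 * (2 * (fst h \<bullet> (Hx *v (fst ?w - x))))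
        + grad \<theta> y \<bullet> snd h + 1 / 2 * (2 * (snd h \<bullet> (Hy *v (snd ?w - y))))
        - lam \<bullet> (A *v fst h + B *v snd h)
        + \<beta> / 2 * (?R \<bullet> (A *v fst h + B *v snd h) + (A *v fst h + B *v snd h) \<bullet> ?R))) (at ?w)"
    by (rule derivative_eq_intros qx qy r refl | simp)+
  moreover have "grad f x \<bullet> fst h + 1 / 2 * (2 * (fst h \<bullet> (Hx *v (fst ?w - x))))
        + grad \<theta> y \<bullet> snd h + 1 / 2 * (2 * (snd h \<bullet> (Hy *v (snd ?w - y))))
        - lam \<bullet> (A *v fst h + B *v snd h)
        + \<beta> / 2 * (?R \<bullet> (A *v fst h + B *v snd h) + (A *v fst h + B *v snd h) \<bullet> ?R) =
     h \<bullet> (lagr_grad_x x y lam + Hx *v p + \<beta> *\<^sub>R (transpose A *v (A *v p + B *v q)),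
          lagr_grad_y x y lam + Hy *v q + \<beta> *\<^sub>R (transpose B *v (A *v p + B *v q)))" for h
    unfolding res_shift lagr_grad_x_def lagr_grad_y_def
    by (cases h) (simp add: inner_transpose_mult inner_mult_transpose inner_add_left inner_diff_left inner_add_right inner_diff_right
        inner_commute algebra_simps)
  ultimately show "(step3_objective x y lam Hx Hy has_derivative (\<lambda>h. h \<bullet> 
    (lagr_grad_x x y lam + Hx *v p + \<beta> *\<^sub>R (transpose A *v (A *v p + B *v q)),
     lagr_grad_y x y lam + Hy *v q + \<beta> *\<^sub>R (transpose B *v (A *v p + B *v q))))) (at ?w)"
    unfolding step3_objective_def case_prod_unfold power2_norm_eq_inner by simp
qed

lemma hatHu_mult:
  "hatHu Hx Hy *v vjoin p q =
    vjoin (Hx *v p + \<beta> *\<^sub>R (transpose A *v (A *v p + B *v q)))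
          (Hy *v q + \<beta> *\<^sub>R (transpose B *v (A *v p + B *v q)))"
  by (simp add: hatHu_def matrix_vector_mult_add_rdistrib scaleR_matrix_vector_assoc[symmetric]
      matrix_vector_mul_assoc[symmetric] transpose_hcat_mult vjoin_add vjoin_scaleR)

text \<open>The inequality constraint now couples both blocks, so only the joint product of
  \<open>\<mu>\<close> with \<open>E p + F q\<close> has a sign: where the multiplier is nonzero,
  \<open>(E p + F q)\<close> equals \<open>- h\<close>, which is nonnegative. With a single
  \<open>\<mu>\<close> the bound on the difference of multipliers is trivial.\<close>

lemma step3_facts:
  assumes adm: "admissible Hx Hy" and feas: "(x, y) \<in> F_plus"
    and st: "step3 x y lam Hx Hy xt yt \<mu> \<alpha>x \<gamma>x \<alpha>y \<gamma>y"
  shows "trial_step x y lam (hatHu Hx Hy) (xt - x) (yt - y) \<mu> \<mu> \<alpha>x \<gamma>x \<alpha>y \<gamma>y"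
    and "E *v (xt - x) + F *v (yt - y) \<le> - hval x y"
    and "in_box l C v xt" and "in_box s D r yt"
proof -
  define p q h where "p = xt - x" and "q = yt - y" and "h = hval x y"
  have xt: "xt = x + p" "yt = y + q" by (simp_all add: p_def q_def)
  have sym: "transpose Hx = Hx" "transpose Hy = Hy" using adm by (auto simp: admissible_def)
  have h: "h $ i \<le> 0" for i using feas by (auto simp: F_plus_def less_eq_vec_def h_def)
  have bx: "in_box l C v x" and by': "in_box s D r y" using feas by (auto simp: F_plus_def)
  have eqx: "lagr_grad_x x y lam + Hx *v p + \<beta> *\<^sub>R (transpose A *v (A *v p + B *v q))
      + transpose E *v \<mu> + transpose C *v (\<gamma>x - \<alpha>x) = 0"
    and eqy: "lagr_grad_y x y lam + Hy *v q + \<beta> *\<^sub>R (transpose B *v (A *v p + B *v q))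
      + transpose F *v \<mu> + transpose D *v (\<gamma>y - \<alpha>y) = 0"
    and cm': "compl \<mu> (- hval xt yt)"
    and kx: "box_compl l C v xt \<alpha>x \<gamma>x" and ky: "box_compl s D r yt \<alpha>y \<gamma>y"
    using st unfolding step3_def xt grad_step3_objective[OF sym] by simp_all
  have cm: "compl \<mu> (- h - (E *v p + F *v q))"
  proof -
    have "- hval xt yt = - h - (E *v p + F *v q)"
      unfolding xt hval_shift h_def by (simp add: algebra_simps)
    then show ?thesis using cm' by simp
  qed
  show "in_box l C v xt" by (rule in_box_of_compl[OF l_range v_range kx])
  show "in_box s D r yt" by (rule in_box_of_compl[OF s_range r_range ky])
  show "E *v (xt - x) + F *v (yt - y) \<le> - hval x y"
    using cm unfolding p_def[symmetric] q_def[symmetric] h_def[symmetric]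
    by (auto simp: less_eq_vec_def compl_real_iff)
  have "0 \<le> \<mu> $ i * (E *v p + F *v q) $ i" for i
  proof -
    have "0 \<le> \<mu> $ i" "\<mu> $ i = 0 \<or> (E *v p + F *v q) $ i = - h $ i"
      using cm by (force simp: compl_real_iff)+
    then show ?thesis using h[of i] by (auto simp: mult_nonneg_nonpos)
  qed
  then have mu: "0 \<le> \<mu> \<bullet> (E *v p + F *v q)" unfolding inner_vec_def by (auto intro!: sum_nonneg)
  have bnd: "0 \<le> (\<gamma>x - \<alpha>x) \<bullet> (C *v p)" "0 \<le> (\<gamma>y - \<alpha>y) \<bullet> (D *v q)"
    using box_compl_inner_nonneg[OF l_range v_range kx bx] box_compl_inner_nonneg[OF s_range r_range ky by']
    by (simp_all add: p_def q_def)
  show "trial_step x y lam (hatHu Hx Hy) (xt - x) (yt - y) \<mu> \<mu> \<alpha>x \<gamma>x \<alpha>y \<gamma>y"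
    unfolding trial_step_def p_def[symmetric] q_def[symmetric]
  proof (intro conjI allI)
    have "vjoin (lagr_grad_x x y lam + Hx *v p + \<beta> *\<^sub>R (transpose A *v (A *v p + B *v q))
           + transpose E *v \<mu> + transpose C *v (\<gamma>x - \<alpha>x))
        (lagr_grad_y x y lam + Hy *v q + \<beta> *\<^sub>R (transpose B *v (A *v p + B *v q))
           + transpose F *v \<mu> + transpose D *v (\<gamma>y - \<alpha>y)) = 0"
      unfolding eqx eqy by simp
    then show eq: "hatHu Hx Hy *v vjoin p q + vjoin (lagr_grad_x x y lam) (lagr_grad_y x y lam)
       + vjoin (transpose E *v \<mu> + transpose C *v (\<gamma>x - \<alpha>x))
               (transpose F *v \<mu> + transpose D *v (\<gamma>y - \<alpha>y)) = 0"
      by (simp add: hatHu_mult vjoin_add add_ac)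
    have "sq_norm (hatHu Hx Hy) (vjoin p q) + (lagr_grad_x x y lam \<bullet> p + lagr_grad_y x y lam \<bullet> q)
        + \<mu> \<bullet> (E *v p + F *v q) + (\<gamma>x - \<alpha>x) \<bullet> (C *v p) + (\<gamma>y - \<alpha>y) \<bullet> (D *v q) = 0"
      using arg_cong[OF eq, of "\<lambda>u. u \<bullet> vjoin p q"]
      by (simp add: inner_add_left inner_add_right inner_transpose_mult sq_norm_def inner_commute[of "vjoin p q"])
    then show "lagr_grad_x x y lam \<bullet> p + lagr_grad_y x y lam \<bullet> q \<le> - sq_norm (hatHu Hx Hy) (vjoin p q)"
      using mu bnd by linarith
    show "norm (\<mu> - \<mu>) \<le> M1 * (norm (p, q) powr \<tau>1 + M2 * norm (res x y) powr \<tau>2)"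
      using M1_pos M2_nonneg by simp
    show "box_compl l C v (x + p) \<alpha>x \<gamma>x" "box_compl s D r (y + q) \<alpha>y \<gamma>y"
      using kx ky by (simp_all add: xt)
    fix i
    show "0 \<le> \<mu> $ i" using cm by (simp add: compl_real_iff)
    have "\<mu> $ i = 0 \<or> - h $ i = (E *v p) $ i + (F *v q) $ i" using cm by (force simp: compl_real_iff)
    moreover have "\<bar>(E *v p) $ i\<bar> \<le> norm (E *v p)" "\<bar>(F *v q) $ i\<bar> \<le> norm (F *v q)"
      by (rule component_le_norm_cart)+
    ultimately show "\<mu> $ i = 0 \<or> - hval x y $ i \<le> 2 * (norm (E *v p) + norm (F *v q))"
      unfolding h_def[symmetric] by fastforce
  qed
qed

text \<open>If the accepted step is not the first trial, \<open>t / \<sigma>\<close> is the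
  preceding trial. It is larger than \<open>t\<close>, so by maximality it must violate the decrease
  condition; this strict violation is the last claim.\<close>

lemma line_search_facts:
  assumes "line_search cmax Hu x y lam p q t" "1 / 2 \<le> cmax"
  shows "0 < t" "t \<le> cmax"
    "lagr (x + t *\<^sub>R p) (y + t *\<^sub>R q) lam \<le> lagr x y lam - \<rho> * t * sq_norm Hu (vjoin p q)"
    "t = cmax \<or> lagr x y lam - \<rho> * (t / \<sigma>) * sq_norm Hu (vjoin p q)
        < lagr (x + (t / \<sigma>) *\<^sub>R p) (y + (t / \<sigma>) *\<^sub>R q) lam"
proof -
  obtain i where i: "t = cmax * \<sigma> ^ i"
    and *: "lagr (x + t *\<^sub>R p) (y + t *\<^sub>R q) lam \<le> lagr x y lam - \<rho> * t * sq_norm Hu (vjoin p q)"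
    using assms(1) by (auto simp: line_search_def is_arg_max_def)
  show "0 < t" using i assms(2) \<sigma>_range by simp
  show "t \<le> cmax" using i assms(2) \<sigma>_range by (simp add: mult_left_le power_le_one)
  show "lagr (x + t *\<^sub>R p) (y + t *\<^sub>R q) lam \<le> lagr x y lam - \<rho> * t * sq_norm Hu (vjoin p q)" by (rule *)
  show "t = cmax \<or> lagr x y lam - \<rho> * (t / \<sigma>) * sq_norm Hu (vjoin p q)
        < lagr (x + (t / \<sigma>) *\<^sub>R p) (y + (t / \<sigma>) *\<^sub>R q) lam"
  proof (cases i)
    case 0 then show ?thesis using i by simp
  next
    case (Suc j)
    have "t < t / \<sigma>" using \<open>0 < t\<close> \<sigma>_range by (simp add: field_simps)
    moreover have "t / \<sigma> \<in> {cmax * \<sigma> ^ i | i :: nat. True}" using i Suc \<sigma>_range by auto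
    ultimately show ?thesis using assms(1) unfolding line_search_def is_arg_max_def
      by (metis not_le)
  qed
qed

text \<open>Both kinds of step satisfy \<open>E p + F q \<le> - (1 / cmax) h\<close>. Hence for
  \<open>t \<le> cmax\<close> the new constraint value is at most
  \<open>(1 - t / cmax) h \<le> 0\<close>. The boxes are convex, and \<open>cmax \<le> 1\<close>
  makes the new point a convex combination of two points in them.\<close>

lemma iteration_facts:
  assumes adm: "admissible Hx Hy" and feas: "(x, y) \<in> F_plus"
    and it: "iteration x y lam Hx Hy \<mu>x \<mu>y \<alpha>x \<gamma>x \<alpha>y \<gamma>y x' y' lam'"
  shows "(x', y') \<in> F_plus"
    and "\<exists>Hu p q cmax t. Hu \<in> {calHu Hx Hy, hatHu Hx Hy} \<and> 1 / 2 \<le> cmax \<and>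
      trial_step x y lam Hu p q \<mu>x \<mu>y \<alpha>x \<gamma>x \<alpha>y \<gamma>y \<and> line_search cmax Hu x y lam p q t \<and>
      x' = x + t *\<^sub>R p \<and> y' = y + t *\<^sub>R q \<and> lam' = lam + \<xi> *\<^sub>R res x' y'"
proof -
  obtain xt1 yt1 \<mu>x1 \<mu>y1 \<alpha>x1 \<gamma>x1 \<alpha>y1 \<gamma>y1 xt yt Hu cmax t where
    s1: "step1_x x y lam Hx xt1 \<mu>x1 \<alpha>x1 \<gamma>x1" "step1_y x y lam Hy yt1 \<mu>y1 \<alpha>y1 \<gamma>y1"
    and s23: "if step2_test x y (xt1 - x) (yt1 - y) \<mu>x1 \<mu>y1
         then xt = xt1 \<and> yt = yt1 \<and> \<mu>x = \<mu>x1 \<and> \<mu>y = \<mu>y1 \<and>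
              \<alpha>x = \<alpha>x1 \<and> \<gamma>x = \<gamma>x1 \<and> \<alpha>y = \<alpha>y1 \<and> \<gamma>y = \<gamma>y1 \<and>
              Hu = calHu Hx Hy \<and> cmax = 1 / (2 - c)
         else step3 x y lam Hx Hy xt yt \<mu>x \<alpha>x \<gamma>x \<alpha>y \<gamma>y \<and> \<mu>y = \<mu>x \<and>
              Hu = hatHu Hx Hy \<and> cmax = 1"
    and ls: "line_search cmax Hu x y lam (xt - x) (yt - y) t"
    and upd: "x' = x + t *\<^sub>R (xt - x)" "y' = y + t *\<^sub>R (yt - y)" "lam' = lam + \<xi> *\<^sub>R res x' y'"
    using it unfolding iteration_def by blast
  have "Hu \<in> {calHu Hx Hy, hatHu Hx Hy} \<and> 1 / 2 \<le> cmax \<and> cmax \<le> 1 \<and>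
      trial_step x y lam Hu (xt - x) (yt - y) \<mu>x \<mu>y \<alpha>x \<gamma>x \<alpha>y \<gamma>y \<and>
      E *v (xt - x) + F *v (yt - y) \<le> - (1 / cmax) *\<^sub>R hval x y \<and> in_box l C v xt \<and> in_box s D r yt"
  proof (cases "step2_test x y (xt1 - x) (yt1 - y) \<mu>x1 \<mu>y1")
    case True
    then have st: "xt = xt1" "yt = yt1" "\<mu>x = \<mu>x1" "\<mu>y = \<mu>y1" "\<alpha>x = \<alpha>x1" "\<gamma>x = \<gamma>x1"
      "\<alpha>y = \<alpha>y1" "\<gamma>y = \<gamma>y1" "Hu = calHu Hx Hy" and cm: "cmax = 1 / (2 - c)"
      using s23 by simp_all
    have "1 / cmax = 2 - c" "1 / 2 \<le> cmax" "cmax \<le> 1"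
      unfolding cm using c_range by (simp_all add: field_simps)
    then show ?thesis unfolding st using step1_facts[OF adm feas s1] True by simp
  next
    case False
    then have "step3 x y lam Hx Hy xt yt \<mu>x \<alpha>x \<gamma>x \<alpha>y \<gamma>y" using s23 by simp
    from step3_facts[OF adm feas this] show ?thesis using False s23 by simp
  qed
  then have Hu: "Hu \<in> {calHu Hx Hy, hatHu Hx Hy}" and cmax: "1 / 2 \<le> cmax" "cmax \<le> 1"
    and ts: "trial_step x y lam Hu (xt - x) (yt - y) \<mu>x \<mu>y \<alpha>x \<gamma>x \<alpha>y \<gamma>y"
    and hd: "E *v (xt - x) + F *v (yt - y) \<le> - (1 / cmax) *\<^sub>R hval x y"
    and box: "in_box l C v xt" "in_box s D r yt" by blast+
  show "\<exists>Hu p q cmax t. Hu \<in> {calHu Hx Hy, hatHu Hx Hy} \<and> 1 / 2 \<le> cmax \<and>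
      trial_step x y lam Hu p q \<mu>x \<mu>y \<alpha>x \<gamma>x \<alpha>y \<gamma>y \<and> line_search cmax Hu x y lam p q t \<and>
      x' = x + t *\<^sub>R p \<and> y' = y + t *\<^sub>R q \<and> lam' = lam + \<xi> *\<^sub>R res x' y'"
    using Hu cmax(1) ts ls upd by blast
  have t: "0 < t" "t \<le> cmax" using line_search_facts[OF ls cmax(1)] by auto
  have "hval x' y' $ i \<le> 0" for i
  proof -
    have "hval x y $ i \<le> 0" using feas by (auto simp: F_plus_def less_eq_vec_def)
    then have "(1 - t / cmax) * hval x y $ i \<le> 0"
      using t cmax by (intro mult_nonneg_nonpos) (auto simp: field_simps)
    moreover have "t * (E *v (xt - x) + F *v (yt - y)) $ i \<le> t * (- (1 / cmax) * hval x y $ i)"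
      using hd t by (intro mult_left_mono) (auto simp: less_eq_vec_def)
    moreover have "hval x' y' $ i = hval x y $ i + t * (E *v (xt - x) + F *v (yt - y)) $ i"
      unfolding upd hval_shift by (simp add: matrix_vector_mult_scaleR algebra_simps)
    ultimately show ?thesis by (simp add: algebra_simps)
  qed
  moreover have "in_box l C v x'" "in_box s D r y'"
    unfolding upd using feas t cmax box by (auto simp: F_plus_def intro!: in_box_convex)
  ultimately show "(x', y') \<in> F_plus" by (auto simp: F_plus_def less_eq_vec_def)
qed

end

section \<open>Limits along a run\<close>

text \<open>A run that has forgotten which subproblem produced each step: \<open>Hu k\<close> and
  \<open>cmax k\<close> are whatever iteration \<open>k\<close> used. The limit analysis therefore
  needs no split of the subsequence according to the outcome of the Step 2 test.\<close>

locale pfd_sqo_steps = pfd_sqo f \<theta> A B b E F d C D l v s r \<rho> \<sigma> \<tau>1 \<tau>2 c \<beta> \<xi> M M1 M2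
  for f :: "real ^ 'n1 \<Rightarrow> real" and \<theta> :: "real ^ 'n2 \<Rightarrow> real"
    and A :: "real ^ 'n1 ^ 'm1" and B :: "real ^ 'n2 ^ 'm1" and b :: "real ^ 'm1"
    and E :: "real ^ 'n1 ^ 'm2" and F :: "real ^ 'n2 ^ 'm2" and d :: "real ^ 'm2"
    and C :: "real ^ 'n1 ^ 'l1" and D :: "real ^ 'n2 ^ 'l2"
    and l v :: "ereal ^ 'l1" and s r :: "ereal ^ 'l2"
    and \<rho> \<sigma> \<tau>1 \<tau>2 c \<beta> \<xi> M M1 M2 :: real +
  fixes x p :: "nat \<Rightarrow> real ^ 'n1" and y q :: "nat \<Rightarrow> real ^ 'n2" and lam :: "nat \<Rightarrow> real ^ 'm1"
    and Hu :: "nat \<Rightarrow> real ^ ('n1 + 'n2) ^ ('n1 + 'n2)"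
    and cmax t :: "nat \<Rightarrow> real" and \<eta> :: real
    and \<mu>x \<mu>y :: "nat \<Rightarrow> real ^ 'm2"
    and \<alpha>x \<gamma>x :: "nat \<Rightarrow> real ^ 'l1" and \<alpha>y \<gamma>y :: "nat \<Rightarrow> real ^ 'l2"
  assumes trial: "trial_step (x k) (y k) (lam k) (Hu k) (p k) (q k) (\<mu>x k) (\<mu>y k) (\<alpha>x k) (\<gamma>x k) (\<alpha>y k) (\<gamma>y k)"
    and search: "line_search (cmax k) (Hu k) (x k) (y k) (lam k) (p k) (q k) (t k)"
    and cmax: "1 / 2 \<le> cmax k"
    and feasible: "(x k, y k) \<in> F_plus"
    and x_Suc: "x (Suc k) = x k + t k *\<^sub>R p k" and y_Suc: "y (Suc k) = y k + t k *\<^sub>R q k"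
    and lam_Suc: "lam (Suc k) = lam k + \<xi> *\<^sub>R res (x (Suc k)) (y (Suc k))"
    and \<eta>_pos: "0 < \<eta>" and coercive: "\<eta> * (norm z)\<^sup>2 \<le> sq_norm (Hu k) z"
    and Hu_bounded: "infinite K \<Longrightarrow> bounded ((\<lambda>k. (x k, y k, lam k)) ` K) \<Longrightarrow> bounded (Hu ` K)"
begin

lemma trial_parts:
  shows "Hu k *v vjoin (p k) (q k) + vjoin (lagr_grad_x (x k) (y k) (lam k)) (lagr_grad_y (x k) (y k) (lam k))
       + vjoin (transpose E *v \<mu>x k + transpose C *v (\<gamma>x k - \<alpha>x k))
               (transpose F *v \<mu>y k + transpose D *v (\<gamma>y k - \<alpha>y k)) = 0"
    and "lagr_grad_x (x k) (y k) (lam k) \<bullet> p k + lagr_grad_y (x k) (y k) (lam k) \<bullet> q k \<le> - sq_norm (Hu k) (vjoin (p k) (q k))"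
    and "0 \<le> \<mu>x k $ i"
    and "\<mu>x k $ i = 0 \<or> - hval (x k) (y k) $ i \<le> 2 * (norm (E *v p k) + norm (F *v q k))"
    and "norm (\<mu>x k - \<mu>y k) \<le> M1 * (norm (p k, q k) powr \<tau>1 + M2 * norm (res (x k) (y k)) powr \<tau>2)"
    and "box_compl l C v (x k + p k) (\<alpha>x k) (\<gamma>x k)" and "box_compl s D r (y k + q k) (\<alpha>y k) (\<gamma>y k)"
  using trial[of k] unfolding trial_step_def by blast+

lemmas line_search = line_search_facts[OF search cmax]

definition lvalue :: "nat \<Rightarrow> real" where
  "lvalue k = lagr (x k) (y k) (lam k)"

lemma lvalue_decrease:
  "\<rho> * \<eta> * (t k * (norm (p k, q k))\<^sup>2) + \<xi> * (norm (res (x (Suc k)) (y (Suc k))))\<^sup>2 \<le> lvalue k - lvalue (Suc k)"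
proof -
  \<comment> \<open>The merit function is affine in the multiplier with slope minus the residual,
    and the update moves along that same residual.\<close>
  have "lvalue (Suc k) = lagr (x (Suc k)) (y (Suc k)) (lam k) - \<xi> * (norm (res (x (Suc k)) (y (Suc k))))\<^sup>2"
    unfolding lvalue_def lagr_def lam_Suc by (simp add: inner_add_left power2_norm_eq_inner)
  moreover have "lagr (x (Suc k)) (y (Suc k)) (lam k) \<le> lvalue k - \<rho> * t k * sq_norm (Hu k) (vjoin (p k) (q k))"
    unfolding lvalue_def x_Suc y_Suc by (rule line_search(3))
  moreover have "\<rho> * t k * (\<eta> * (norm (p k, q k))\<^sup>2) \<le> \<rho> * t k * sq_norm (Hu k) (vjoin (p k) (q k))"
    using coercive[of "vjoin (p k) (q k)" k] \<rho>_range line_search(1)[of k]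
    by (intro mult_left_mono) (auto simp: norm_vjoin)
  ultimately show ?thesis by (simp add: algebra_simps)
qed

text \<open>The assumption concerns a subsequence, the conclusion the whole sequence:
  \<open>lvalue\<close> is decreasing, so its limit along the subsequence is a lower bound for all
  its values. It converges, and its successive differences, which dominate both quantities, tend to
  0.\<close>

lemma step_size_and_residual_vanish:
  assumes \<kappa>: "strict_mono \<kappa>"
    and lim: "(\<lambda>n. x (\<kappa> n)) \<longlonglongrightarrow> xs" "(\<lambda>n. y (\<kappa> n)) \<longlonglongrightarrow> ys" "(\<lambda>n. lam (\<kappa> n)) \<longlonglongrightarrow> ls"
  shows "(\<lambda>k. t k * (norm (p k, q k))\<^sup>2) \<longlonglongrightarrow> 0" and "(\<lambda>k. res (x k) (y k)) \<longlonglongrightarrow> 0"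
proof -
  let ?a = "\<lambda>k. \<rho> * \<eta> * (t k * (norm (p k, q k))\<^sup>2)" and ?b = "\<lambda>k. \<xi> * (norm (res (x (Suc k)) (y (Suc k))))\<^sup>2"
  have nn: "0 \<le> ?a k" "0 \<le> ?b k" for k
    using \<rho>_range \<eta>_pos \<xi>_pos line_search(1)[of k] by auto
  have le: "?a k \<le> lvalue k - lvalue (Suc k)" "?b k \<le> lvalue k - lvalue (Suc k)" for k
    using lvalue_decrease[of k] nn[of k] by linarith+
  have dec: "decseq lvalue"
  proof (rule decseq_SucI)
    show "lvalue (Suc k) \<le> lvalue k" for k using le(1)[of k] nn(1)[of k] by linarith
  qed
  have Ls: "(\<lambda>n. lvalue (\<kappa> n)) \<longlonglongrightarrow> lagr xs ys ls"
    unfolding lvalue_def by (rule tendsto_lagr[OF lim])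
  have "lagr xs ys ls \<le> lvalue k" for k
  proof (rule LIMSEQ_le_const2[OF Ls], intro exI allI impI)
    fix n assume "k \<le> n"
    then have "k \<le> \<kappa> n" using seq_suble[OF \<kappa>, of n] by linarith
    then show "lvalue (\<kappa> n) \<le> lvalue k" using dec by (simp add: decseqD)
  qed
  then obtain L where L: "lvalue \<longlonglongrightarrow> L"
    using decseq_convergent[OF dec] by metis
  have diff: "(\<lambda>k. lvalue k - lvalue (Suc k)) \<longlonglongrightarrow> 0"
    using tendsto_diff[OF L LIMSEQ_Suc[OF L]] by simp
  have "?a \<longlonglongrightarrow> 0"
    by (rule tendsto_sandwich[OF _ _ tendsto_const diff]; intro always_eventually allI nn le)
  then have "(\<lambda>k. inverse (\<rho> * \<eta>) * ?a k) \<longlonglongrightarrow> inverse (\<rho> * \<eta>) * 0" by (intro tendsto_intros)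
  then show "(\<lambda>k. t k * (norm (p k, q k))\<^sup>2) \<longlonglongrightarrow> 0" using \<rho>_range \<eta>_pos by (simp add: field_simps)
  have "?b \<longlonglongrightarrow> 0"
    by (rule tendsto_sandwich[OF _ _ tendsto_const diff]; intro always_eventually allI nn le)
  then have "(\<lambda>k. sqrt (inverse \<xi> * ?b k)) \<longlonglongrightarrow> sqrt (inverse \<xi> * 0)" by (intro tendsto_intros)
  then have "(\<lambda>k. norm (res (x (Suc k)) (y (Suc k)))) \<longlonglongrightarrow> 0" using \<xi>_pos by (simp add: field_simps)
  then have "(\<lambda>k. res (x (Suc k)) (y (Suc k))) \<longlonglongrightarrow> 0" by (rule tendsto_norm_zero_cancel)
  \<comment> \<open>The decrease at iteration \<open>k\<close> controls the residual at
    \<open>k + 1\<close>. Convergence along all indices makes this shift harmless; along a mere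
    subsequence it would not be.\<close>
  then show "(\<lambda>k. res (x k) (y k)) \<longlonglongrightarrow> 0" by (rule LIMSEQ_imp_Suc)
qed

lemma slope_le: "lagr_grad_x (x k) (y k) (lam k) \<bullet> p k + lagr_grad_y (x k) (y k) (lam k) \<bullet> q k \<le> - \<eta> * (norm (p k, q k))\<^sup>2"
  using trial_parts(2)[of k] coercive[of "vjoin (p k) (q k)" k] by (simp add: trial_step_def norm_vjoin)

text \<open>Coercivity against Cauchy-Schwarz. The gradients on the right converge along convergent
  iterates, so the directions stay bounded there.\<close>

lemma direction_bound:
  "norm (p k, q k) \<le> norm (lagr_grad_x (x k) (y k) (lam k), lagr_grad_y (x k) (y k) (lam k)) / \<eta>"
proof -
  let ?g = "(lagr_grad_x (x k) (y k) (lam k), lagr_grad_y (x k) (y k) (lam k))" and ?w = "(p k, q k)"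
  have "\<eta> * (norm ?w)\<^sup>2 \<le> - (?g \<bullet> ?w)" using slope_le[of k] by simp
  also have "\<dots> \<le> norm ?g * norm ?w" using Cauchy_Schwarz_ineq2[of ?g ?w] by linarith
  finally have "(\<eta> * norm ?w) * norm ?w \<le> norm ?g * norm ?w" by (simp add: power2_eq_square mult_ac)
  then show ?thesis
    using \<eta>_pos by (cases "?w = 0") (simp_all add: field_simps mult_le_cancel_right)
qed

text \<open>If the directions had a nonzero limit, the accepted step sizes would tend to 0, so that the
  step \<open>t / \<sigma>\<close> is rejected; its mean value slope is then too large for the limit slope.\<close>
lemma direction_limit_zero:
  assumes \<kappa>: "strict_mono \<kappa>"
    and lim: "(\<lambda>n. x (\<kappa> n)) \<longlonglongrightarrow> xs" "(\<lambda>n. y (\<kappa> n)) \<longlonglongrightarrow> ys" "(\<lambda>n. lam (\<kappa> n)) \<longlonglongrightarrow> ls"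
    and dir: "(\<lambda>n. p (\<kappa> n)) \<longlonglongrightarrow> ps" "(\<lambda>n. q (\<kappa> n)) \<longlonglongrightarrow> qs"
  shows "ps = 0 \<and> qs = 0"
proof (rule ccontr)
  assume "\<not> (ps = 0 \<and> qs = 0)"
  then have ne: "norm (ps, qs) \<noteq> 0" by (simp add: zero_prod_def)
  have nlim: "(\<lambda>n. norm (p (\<kappa> n), q (\<kappa> n))) \<longlonglongrightarrow> norm (ps, qs)" by (intro tendsto_intros dir)
  have "(\<lambda>n. t (\<kappa> n) * (norm (p (\<kappa> n), q (\<kappa> n)))\<^sup>2) \<longlonglongrightarrow> 0"
    using LIMSEQ_subseq_LIMSEQ[OF step_size_and_residual_vanish(1)[OF \<kappa> lim] \<kappa>] by (simp add: o_def)
  then have "(\<lambda>n. t (\<kappa> n) * (norm (p (\<kappa> n), q (\<kappa> n)))\<^sup>2 / (norm (p (\<kappa> n), q (\<kappa> n)))\<^sup>2) \<longlonglongrightarrow> 0 / (norm (ps, qs))\<^sup>2"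
    using ne by (intro tendsto_intros nlim) auto
  moreover have "\<forall>\<^sub>F n in sequentially. t (\<kappa> n) * (norm (p (\<kappa> n), q (\<kappa> n)))\<^sup>2 / (norm (p (\<kappa> n), q (\<kappa> n)))\<^sup>2 = t (\<kappa> n)"
    using tendsto_imp_eventually_ne[OF nlim ne] by eventually_elim simp
  ultimately have t0: "(\<lambda>n. t (\<kappa> n)) \<longlonglongrightarrow> 0" by (simp add: tendsto_cong)
  define slope where "slope n a = lagr_grad_x (x (\<kappa> n) + a *\<^sub>R p (\<kappa> n)) (y (\<kappa> n) + a *\<^sub>R q (\<kappa> n)) (lam (\<kappa> n)) \<bullet> p (\<kappa> n)
     + lagr_grad_y (x (\<kappa> n) + a *\<^sub>R p (\<kappa> n)) (y (\<kappa> n) + a *\<^sub>R q (\<kappa> n)) (lam (\<kappa> n)) \<bullet> q (\<kappa> n)" for n a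
  let ?Q = "\<lambda>n. sq_norm (Hu (\<kappa> n)) (vjoin (p (\<kappa> n)) (q (\<kappa> n)))"
  \<comment> \<open>The first trial is at least 1/2, so a step size below 1/2 was not the first one
    and \<open>t / \<sigma>\<close> was rejected. The mean value theorem on the rejected interval
    turns this into a lower bound for an intermediate slope.\<close>
  have "\<exists>a. 0 < a \<and> a < t (\<kappa> n) / \<sigma> \<and> (t (\<kappa> n) < 1 / 2 \<longrightarrow> - \<rho> * ?Q n < slope n a)" for n
  proof -
    let ?\<tau> = "t (\<kappa> n) / \<sigma>"
    let ?L = "\<lambda>a. lagr (x (\<kappa> n) + a *\<^sub>R p (\<kappa> n)) (y (\<kappa> n) + a *\<^sub>R q (\<kappa> n)) (lam (\<kappa> n))"
    have \<tau>: "0 < ?\<tau>" using line_search(1) \<sigma>_range by simp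
    obtain a where a: "0 < a" "a < ?\<tau>" "?L ?\<tau> - ?L 0 = (?\<tau> - 0) * slope n a"
      using MVT2[OF \<tau>, of ?L "slope n"] lagr_line_derivative[of "x (\<kappa> n)" "p (\<kappa> n)" "y (\<kappa> n)" "q (\<kappa> n)" "lam (\<kappa> n)"]
      unfolding slope_def by blast
    have "- \<rho> * ?Q n < slope n a" if "t (\<kappa> n) < 1 / 2"
    proof -
      have "?L 0 - \<rho> * ?\<tau> * ?Q n < ?L ?\<tau>" using line_search(4)[of "\<kappa> n"] cmax[of "\<kappa> n"] that by auto
      then have "?\<tau> * (- \<rho> * ?Q n) < ?\<tau> * slope n a" using a(3) by (simp add: algebra_simps)
      then show ?thesis using \<tau> mult_less_cancel_left_pos by blast
    qed
    then show ?thesis using a by blast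
  qed
  then obtain a where a: "\<And>n. 0 < a n \<and> a n < t (\<kappa> n) / \<sigma> \<and> (t (\<kappa> n) < 1 / 2 \<longrightarrow> - \<rho> * ?Q n < slope n (a n))"
    by metis
  have "(\<lambda>n. t (\<kappa> n) / \<sigma>) \<longlonglongrightarrow> 0 / \<sigma>" using \<sigma>_range by (intro tendsto_intros t0) auto
  then have t\<sigma>: "(\<lambda>n. t (\<kappa> n) / \<sigma>) \<longlonglongrightarrow> 0" by simp
  have a0: "a \<longlonglongrightarrow> 0"
    by (rule tendsto_sandwich[OF _ _ tendsto_const t\<sigma>]) (use a in \<open>auto intro!: always_eventually less_imp_le\<close>)
  have slope_lim: "(\<lambda>n. slope n (u n)) \<longlonglongrightarrow> lagr_grad_x xs ys ls \<bullet> ps + lagr_grad_y xs ys ls \<bullet> qs" if "u \<longlonglongrightarrow> 0" for u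
  proof -
    have "(\<lambda>n. x (\<kappa> n) + u n *\<^sub>R p (\<kappa> n)) \<longlonglongrightarrow> xs + 0 *\<^sub>R ps" "(\<lambda>n. y (\<kappa> n) + u n *\<^sub>R q (\<kappa> n)) \<longlonglongrightarrow> ys + 0 *\<^sub>R qs"
      by (intro tendsto_intros lim dir that)+
    then show ?thesis unfolding slope_def
      by (intro tendsto_intros dir tendsto_lagr_gradient lim(3)) auto
  qed
  \<comment> \<open>The intermediate slope exceeds \<open>- \<rho>\<close> times the curvature,
    while the initial slope is at most minus the curvature. The curvature itself need not converge,
    because the matrices need not; it is replaced by its coercive lower bound before taking
    limits.\<close>
  have low: "\<forall>\<^sub>F n in sequentially. (1 - \<rho>) * (\<eta> * (norm (p (\<kappa> n), q (\<kappa> n)))\<^sup>2) \<le> slope n (a n) - slope n 0"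
  proof -
    have "\<forall>\<^sub>F n in sequentially. t (\<kappa> n) < 1 / 2" using order_tendstoD(2)[OF t0, of "1 / 2"] by simp
    then show ?thesis
    proof eventually_elim
      case (elim n)
      have "slope n 0 \<le> - ?Q n" using trial_parts(2)[of "\<kappa> n"] by (simp add: slope_def)
      then have "(1 - \<rho>) * ?Q n \<le> slope n (a n) - slope n 0" using a[of n] elim by (simp add: algebra_simps)
      moreover have "(1 - \<rho>) * (\<eta> * (norm (p (\<kappa> n), q (\<kappa> n)))\<^sup>2) \<le> (1 - \<rho>) * ?Q n"
        using coercive[of "vjoin (p (\<kappa> n)) (q (\<kappa> n))" "\<kappa> n"] \<rho>_range
        by (intro mult_left_mono) (auto simp: norm_vjoin)
      ultimately show ?case by linarith
    qed
  qed
  have l1: "(\<lambda>n. (1 - \<rho>) * (\<eta> * (norm (p (\<kappa> n), q (\<kappa> n)))\<^sup>2)) \<longlonglongrightarrow> (1 - \<rho>) * (\<eta> * (norm (ps, qs))\<^sup>2)"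
    by (intro tendsto_intros nlim)
  have l2: "(\<lambda>n. slope n (a n) - slope n 0) \<longlonglongrightarrow> 0"
    using tendsto_diff[OF slope_lim[OF a0] slope_lim[OF tendsto_const]] by simp
  have "(1 - \<rho>) * (\<eta> * (norm (ps, qs))\<^sup>2) \<le> 0"
    by (rule tendsto_le[OF trivial_limit_sequentially l2 l1 low])
  moreover have "0 < (1 - \<rho>) * (\<eta> * (norm (ps, qs))\<^sup>2)" using \<rho>_range \<eta>_pos ne by simp
  ultimately show False by linarith
qed

text \<open>Bolzano-Weierstrass supplies the limit direction that
  \<open>direction_limit_zero\<close> needs. A further subsequence costs nothing, as the theorem
  only asks for some index set \<open>K\<close>.\<close>

lemma directions_vanish_along_subsequence:
  assumes \<kappa>: "strict_mono \<kappa>"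
    and lim: "(\<lambda>n. x (\<kappa> n)) \<longlonglongrightarrow> xs" "(\<lambda>n. y (\<kappa> n)) \<longlonglongrightarrow> ys" "(\<lambda>n. lam (\<kappa> n)) \<longlonglongrightarrow> ls"
  obtains \<phi> where "strict_mono \<phi>" "(\<lambda>n. p (\<kappa> (\<phi> n))) \<longlonglongrightarrow> 0" "(\<lambda>n. q (\<kappa> (\<phi> n))) \<longlonglongrightarrow> 0"
proof -
  have "(\<lambda>n. norm (lagr_grad_x (x (\<kappa> n)) (y (\<kappa> n)) (lam (\<kappa> n)), lagr_grad_y (x (\<kappa> n)) (y (\<kappa> n)) (lam (\<kappa> n))) / \<eta>)
      \<longlonglongrightarrow> norm (lagr_grad_x xs ys ls, lagr_grad_y xs ys ls) / \<eta>"
    using \<eta>_pos by (intro tendsto_intros tendsto_lagr_gradient lim) auto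
  then have "Bseq (\<lambda>n. norm (lagr_grad_x (x (\<kappa> n)) (y (\<kappa> n)) (lam (\<kappa> n)), lagr_grad_y (x (\<kappa> n)) (y (\<kappa> n)) (lam (\<kappa> n))) / \<eta>)"
    by (intro convergent_imp_Bseq convergentI)
  then obtain N where N: "\<And>n. norm (norm (lagr_grad_x (x (\<kappa> n)) (y (\<kappa> n)) (lam (\<kappa> n)), lagr_grad_y (x (\<kappa> n)) (y (\<kappa> n)) (lam (\<kappa> n))) / \<eta>) \<le> N"
    by (auto simp: Bseq_def)
  have "norm (p (\<kappa> n), q (\<kappa> n)) \<le> N" for n
    using direction_bound[of "\<kappa> n"] N[of n] by (smt (verit) real_norm_def)
  then have "bounded (range (\<lambda>n. (p (\<kappa> n), q (\<kappa> n))))" by (auto simp: bounded_iff)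
  then obtain z \<phi> where \<phi>: "strict_mono \<phi>" and z: "((\<lambda>n. (p (\<kappa> n), q (\<kappa> n))) \<circ> \<phi>) \<longlonglongrightarrow> z"
    using bounded_imp_convergent_subsequence by blast
  have pq: "(\<lambda>n. p (\<kappa> (\<phi> n))) \<longlonglongrightarrow> fst z" "(\<lambda>n. q (\<kappa> (\<phi> n))) \<longlonglongrightarrow> snd z"
    using tendsto_fst[OF z] tendsto_snd[OF z] by (simp_all add: o_def)
  have "fst z = 0 \<and> snd z = 0"
    using direction_limit_zero[OF strict_mono_o[OF \<kappa> \<phi>], of xs ys ls "fst z" "snd z"] pq
      LIMSEQ_subseq_LIMSEQ[OF lim(1) \<phi>] LIMSEQ_subseq_LIMSEQ[OF lim(2) \<phi>] LIMSEQ_subseq_LIMSEQ[OF lim(3) \<phi>]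
    by (simp add: o_def)
  then show ?thesis using that[OF \<phi>] pq by simp
qed

lemma multipliers_converge:
  assumes \<kappa>: "strict_mono \<kappa>"
    and lim: "(\<lambda>n. x (\<kappa> n)) \<longlonglongrightarrow> xs" "(\<lambda>n. y (\<kappa> n)) \<longlonglongrightarrow> ys" "(\<lambda>n. lam (\<kappa> n)) \<longlonglongrightarrow> ls"
    and dir: "(\<lambda>n. p (\<kappa> n)) \<longlonglongrightarrow> 0" "(\<lambda>n. q (\<kappa> n)) \<longlonglongrightarrow> 0"
    and rank: "full_row_rank_on constraint_matrix (active_set xs ys)"
  shows "\<exists>\<mu> \<alpha>1 \<gamma>1 \<alpha>2 \<gamma>2.
     (\<lambda>n. (\<mu>x (\<kappa> n), \<mu>y (\<kappa> n), \<alpha>x (\<kappa> n), \<gamma>x (\<kappa> n), \<alpha>y (\<kappa> n), \<gamma>y (\<kappa> n))) \<longlonglongrightarrow> (\<mu>, \<mu>, \<alpha>1, \<gamma>1, \<alpha>2, \<gamma>2) \<and>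
     kkt_solution xs ys ls \<mu> \<alpha>1 \<gamma>1 \<alpha>2 \<gamma>2"
proof -
  note mv_tendsto = bounded_linear.tendsto[OF matrix_vector_mul_bounded_linear]
  have res0: "(\<lambda>n. res (x (\<kappa> n)) (y (\<kappa> n))) \<longlonglongrightarrow> 0"
    using LIMSEQ_subseq_LIMSEQ[OF step_size_and_residual_vanish(2)[OF \<kappa> lim] \<kappa>] by (simp add: o_def)
  then have feas_eq: "res xs ys = 0"
    using tendsto_res[OF lim(1,2)] LIMSEQ_unique by blast
  have hs: "hval xs ys $ i \<le> 0" for i
    by (rule LIMSEQ_le_const2[OF tendsto_vec_nth[OF tendsto_hval[OF lim(1,2)]]])
      (use feasible in \<open>auto simp: F_plus_def less_eq_vec_def\<close>)
  have tx: "(\<lambda>n. x (\<kappa> n) + p (\<kappa> n)) \<longlonglongrightarrow> xs" and ty: "(\<lambda>n. y (\<kappa> n) + q (\<kappa> n)) \<longlonglongrightarrow> ys"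
    using tendsto_add[OF lim(1) dir(1)] tendsto_add[OF lim(2) dir(2)] by simp_all

  \<comment> \<open>Convergent iterates are bounded, so the matrices along the subsequence are
    bounded too; they need not converge, since the vectors they act on tend to 0.\<close>
  have Hd: "(\<lambda>n. Hu (\<kappa> n) *v vjoin (p (\<kappa> n)) (q (\<kappa> n))) \<longlonglongrightarrow> 0"
  proof -
    have "(\<lambda>n. (x (\<kappa> n), y (\<kappa> n), lam (\<kappa> n))) \<longlonglongrightarrow> (xs, ys, ls)" by (intro tendsto_intros lim)
    then have "bounded (range (\<lambda>n. (x (\<kappa> n), y (\<kappa> n), lam (\<kappa> n))))" by (rule convergent_imp_bounded)
    moreover have "infinite (range \<kappa>)" using \<kappa> by (simp add: range_inj_infinite strict_mono_imp_inj_on)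
    ultimately have "bounded (Hu ` range \<kappa>)" by (intro Hu_bounded) (auto simp: image_image)
    then obtain N where N: "\<And>n. norm (Hu (\<kappa> n)) \<le> N" by (auto simp: bounded_iff)
    let ?c = "real CARD('n1 + 'n2) * N"
    have bnd: "norm (Hu (\<kappa> n) *v vjoin (p (\<kappa> n)) (q (\<kappa> n))) \<le> ?c * norm (p (\<kappa> n), q (\<kappa> n))" for n
    proof -
      have "norm (Hu (\<kappa> n) *v vjoin (p (\<kappa> n)) (q (\<kappa> n)))
          \<le> real CARD('n1 + 'n2) * norm (Hu (\<kappa> n)) * norm (vjoin (p (\<kappa> n)) (q (\<kappa> n)))"
        by (rule norm_mult_vec_le)
      also have "\<dots> \<le> ?c * norm (p (\<kappa> n), q (\<kappa> n))"
        unfolding norm_vjoin by (intro mult_right_mono mult_left_mono N) auto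
      finally show ?thesis .
    qed
    have "(\<lambda>n. ?c * norm (p (\<kappa> n), q (\<kappa> n))) \<longlonglongrightarrow> ?c * norm (0 :: real ^ 'n1, 0 :: real ^ 'n2)"
      by (intro tendsto_intros dir)
    then have lim0: "(\<lambda>n. ?c * norm (p (\<kappa> n), q (\<kappa> n))) \<longlonglongrightarrow> 0"
      by (simp only: zero_prod_def[symmetric] norm_zero mult_zero_right)
    show ?thesis
      by (rule Lim_null_comparison[OF always_eventually lim0]) (intro allI bnd)
  qed

  have \<mu>diff: "(\<lambda>n. \<mu>x (\<kappa> n) - \<mu>y (\<kappa> n)) \<longlonglongrightarrow> 0"
  proof (rule Lim_null_comparison)
    let ?g = "\<lambda>n. M1 * (norm (p (\<kappa> n), q (\<kappa> n)) powr \<tau>1 + M2 * norm (res (x (\<kappa> n)) (y (\<kappa> n))) powr \<tau>2)"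
    show "\<forall>\<^sub>F n in sequentially. norm (\<mu>x (\<kappa> n) - \<mu>y (\<kappa> n)) \<le> ?g n"
      by (intro always_eventually allI trial_parts)
    have "(\<lambda>n. norm (p (\<kappa> n), q (\<kappa> n))) \<longlonglongrightarrow> norm (0 :: real ^ 'n1, 0 :: real ^ 'n2)"
      by (intro tendsto_intros dir)
    then have n0: "(\<lambda>n. norm (p (\<kappa> n), q (\<kappa> n))) \<longlonglongrightarrow> 0"
      by (simp only: zero_prod_def[symmetric] norm_zero)
    \<comment> \<open>Positivity of the exponents makes the powers continuous at 0 with value 0
      there.\<close>
    have "?g \<longlonglongrightarrow> M1 * (0 powr \<tau>1 + M2 * 0 powr \<tau>2)"
      using \<tau>_pos by (intro tendsto_intros tendsto_powr' n0 tendsto_norm_zero[OF res0]) auto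
    then show "?g \<longlonglongrightarrow> 0" by simp
  qed

  \<comment> \<open>Only \<open>\<mu>x\<close> is stacked. Replacing \<open>\<mu>y\<close> by it in
    the second block leaves the vanishing error computed in \<open>stat\<close>.\<close>
  define m where "m n = vjoin (\<mu>x (\<kappa> n)) (vjoin (\<gamma>x (\<kappa> n) - \<alpha>x (\<kappa> n)) (\<gamma>y (\<kappa> n) - \<alpha>y (\<kappa> n)))" for n
  let ?T = "\<lambda>u. transpose constraint_matrix *v u"
  have stat: "?T (m n) = vjoin 0 (transpose F *v (\<mu>x (\<kappa> n) - \<mu>y (\<kappa> n)))
      - (Hu (\<kappa> n) *v vjoin (p (\<kappa> n)) (q (\<kappa> n))
      + vjoin (lagr_grad_x (x (\<kappa> n)) (y (\<kappa> n)) (lam (\<kappa> n))) (lagr_grad_y (x (\<kappa> n)) (y (\<kappa> n)) (lam (\<kappa> n))))" for n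
  proof -
    have "Hu (\<kappa> n) *v vjoin (p (\<kappa> n)) (q (\<kappa> n))
      + vjoin (lagr_grad_x (x (\<kappa> n)) (y (\<kappa> n)) (lam (\<kappa> n))) (lagr_grad_y (x (\<kappa> n)) (y (\<kappa> n)) (lam (\<kappa> n)))
      + (?T (m n) - vjoin 0 (transpose F *v (\<mu>x (\<kappa> n) - \<mu>y (\<kappa> n)))) = 0"
    proof -
      have "?T (m n) = vjoin (transpose E *v \<mu>x (\<kappa> n) + transpose C *v (\<gamma>x (\<kappa> n) - \<alpha>x (\<kappa> n)))
               (transpose F *v \<mu>y (\<kappa> n) + transpose D *v (\<gamma>y (\<kappa> n) - \<alpha>y (\<kappa> n)))
             + vjoin 0 (transpose F *v (\<mu>x (\<kappa> n) - \<mu>y (\<kappa> n)))"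
        unfolding m_def transpose_constraint_matrix_mult vjoin_add by (simp add: mv_simps)
      then show ?thesis using trial_parts(1)[of "\<kappa> n"] by simp
    qed
    then show ?thesis by (simp add: algebra_simps eq_neg_iff_add_eq_0)
  qed
  have "(\<lambda>n. ?T (m n)) \<longlonglongrightarrow> vjoin 0 (transpose F *v 0) - (0 + vjoin (lagr_grad_x xs ys ls) (lagr_grad_y xs ys ls))"
    unfolding stat by (intro tendsto_intros mv_tendsto \<mu>diff Hd tendsto_lagr_gradient lim)
  then have Tlim: "(\<lambda>n. ?T (m n)) \<longlonglongrightarrow> - vjoin (lagr_grad_x xs ys ls) (lagr_grad_y xs ys ls)"
    by simp

  note bx = trial_parts(6)[of "\<kappa> _"] and by' = trial_parts(7)[of "\<kappa> _"]
  have suppx: "\<forall>\<^sub>F n in sequentially. \<forall>i. i \<notin> active_rows l C v xs \<longrightarrow> (\<gamma>x (\<kappa> n) - \<alpha>x (\<kappa> n)) $ i = 0"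
    by (rule box_compl_support_limit[OF l_range v_range bx tx])
  have suppy: "\<forall>\<^sub>F n in sequentially. \<forall>i. i \<notin> active_rows s D r ys \<longrightarrow> (\<gamma>y (\<kappa> n) - \<alpha>y (\<kappa> n)) $ i = 0"
    by (rule box_compl_support_limit[OF s_range r_range by' ty])
  have supp\<mu>i: "\<forall>\<^sub>F n in sequentially. hval xs ys $ i = 0 \<or> \<mu>x (\<kappa> n) $ i = 0" for i
  proof (cases "hval xs ys $ i = 0")
    case False
    \<comment> \<open>For a constraint inactive at the limit this gap tends to a positive number, so
      the second alternative in \<open>trial_step\<close> eventually fails and the multiplier must
      be 0.\<close>
    have "(\<lambda>n. - hval (x (\<kappa> n)) (y (\<kappa> n)) $ i - 2 * (norm (E *v p (\<kappa> n)) + norm (F *v q (\<kappa> n))))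
        \<longlonglongrightarrow> - hval xs ys $ i - 2 * (norm (E *v (0 :: real ^ 'n1)) + norm (F *v (0 :: real ^ 'n2)))"
      by (intro tendsto_intros tendsto_hval lim mv_tendsto dir)
    moreover have "0 < - hval xs ys $ i - 2 * (norm (E *v (0 :: real ^ 'n1)) + norm (F *v (0 :: real ^ 'n2)))"
      using False hs[of i] by simp
    ultimately have "\<forall>\<^sub>F n in sequentially. 0 < - hval (x (\<kappa> n)) (y (\<kappa> n)) $ i - 2 * (norm (E *v p (\<kappa> n)) + norm (F *v q (\<kappa> n)))"
      by (rule order_tendstoD(1))
    then show ?thesis
    proof eventually_elim
      case (elim n)
      then show ?case using trial_parts(4)[of "\<kappa> n" i] by auto
    qed
  qed simp
  then have supp\<mu>: "\<forall>\<^sub>F n in sequentially. \<forall>i. hval xs ys $ i = 0 \<or> \<mu>x (\<kappa> n) $ i = 0"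
    by (intro eventually_all_finite) auto

  define V :: "(real ^ ('m2 + ('l1 + 'l2))) set" where "V = {u. \<forall>i. i \<notin> active_set xs ys \<longrightarrow> u $ i = 0}"
  have mV: "\<forall>\<^sub>F n in sequentially. m n \<in> V"
    using suppx suppy supp\<mu>
  proof eventually_elim
    case (elim n)
    have "m n $ i = 0" if "i \<notin> active_set xs ys" for i
    proof (cases i)
      case (Inl a) then show ?thesis using elim that by (auto simp: m_def active_set_def)
    next
      case (Inr a) then show ?thesis using elim that by (cases a) (auto simp: m_def active_set_def)
    qed
    then show ?case by (auto simp: V_def)
  qed
  have sub: "subspace V" by (auto simp: subspace_def V_def)
  have lin: "linear ?T" by simp
  have "inj_on ?T V"
    unfolding linear_injective_on_subspace_0[OF lin sub]
    using full_row_rank_on_inj[OF rank] by (auto simp: V_def)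
  \<comment> \<open>Full row rank makes the transposed matrix injective on vectors supported on the
    active set. A linear left inverse is continuous in finite dimension, so convergence of
    \<open>?T (m n)\<close> forces convergence of \<open>m n\<close>, which lies in \<open>V\<close>
    for late \<open>n\<close>.\<close>
  then obtain g where g: "linear g" "\<And>u. u \<in> V \<Longrightarrow> g (?T u) = u"
    using linear_exists_left_inverse_on[OF lin sub] by blast
  define ms where "ms = g (- vjoin (lagr_grad_x xs ys ls) (lagr_grad_y xs ys ls))"
  have "(\<lambda>n. g (?T (m n))) \<longlonglongrightarrow> ms"
    unfolding ms_def using g(1) by (intro bounded_linear.tendsto[OF _ Tlim]) (rule linear_conv_bounded_linear[THEN iffD1])
  moreover have "\<forall>\<^sub>F n in sequentially. g (?T (m n)) = m n" using mV by eventually_elim (rule g(2))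
  ultimately have mlim: "m \<longlonglongrightarrow> ms" by (rule Lim_transform_eventually)
  have Tms: "?T ms = - vjoin (lagr_grad_x xs ys ls) (lagr_grad_y xs ys ls)"
    using LIMSEQ_unique[OF mv_tendsto[OF mlim] Tlim] .

  define \<mu> where "\<mu> = (\<chi> i. ms $ Inl i)"
  define \<delta>1 where "\<delta>1 = (\<chi> i. ms $ Inr (Inl i))"
  define \<delta>2 where "\<delta>2 = (\<chi> i. ms $ Inr (Inr i))"
  have ms_eq: "ms = vjoin \<mu> (vjoin \<delta>1 \<delta>2)"
    by (auto simp: vec_eq_iff vjoin_def \<mu>_def \<delta>1_def \<delta>2_def split: sum.split)
  have mnth: "(\<lambda>n. m n $ i) \<longlonglongrightarrow> ms $ i" for i using mlim by (rule tendsto_vec_nth)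
  have \<mu>lim: "(\<lambda>n. \<mu>x (\<kappa> n)) \<longlonglongrightarrow> \<mu>"
    by (rule vec_tendstoI) (use mnth[of "Inl _"] in \<open>simp add: m_def \<mu>_def\<close>)
  have \<delta>1lim: "(\<lambda>n. \<gamma>x (\<kappa> n) - \<alpha>x (\<kappa> n)) \<longlonglongrightarrow> \<delta>1"
    by (rule vec_tendstoI) (use mnth[of "Inr (Inl _)"] in \<open>simp add: m_def \<delta>1_def\<close>)
  have \<delta>2lim: "(\<lambda>n. \<gamma>y (\<kappa> n) - \<alpha>y (\<kappa> n)) \<longlonglongrightarrow> \<delta>2"
    by (rule vec_tendstoI) (use mnth[of "Inr (Inr _)"] in \<open>simp add: m_def \<delta>2_def\<close>)
  have \<mu>ylim: "(\<lambda>n. \<mu>y (\<kappa> n)) \<longlonglongrightarrow> \<mu>" using tendsto_diff[OF \<mu>lim \<mu>diff] by simp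
  \<comment> \<open>The limit of a difference does not by itself give the limits of its terms; they
    come from the positive and negative parts, which are continuous and agree with the multipliers
    at every iteration by \<open>box_compl_pos_parts\<close>.\<close>
  define \<alpha>1 where "\<alpha>1 = (\<chi> i. max 0 (- \<delta>1 $ i))"
  define \<gamma>1 where "\<gamma>1 = (\<chi> i. max 0 (\<delta>1 $ i))"
  define \<alpha>2 where "\<alpha>2 = (\<chi> i. max 0 (- \<delta>2 $ i))"
  define \<gamma>2 where "\<gamma>2 = (\<chi> i. max 0 (\<delta>2 $ i))"
  have lims: "(\<lambda>n. \<alpha>x (\<kappa> n)) \<longlonglongrightarrow> \<alpha>1" "(\<lambda>n. \<gamma>x (\<kappa> n)) \<longlonglongrightarrow> \<gamma>1"
    "(\<lambda>n. \<alpha>y (\<kappa> n)) \<longlonglongrightarrow> \<alpha>2" "(\<lambda>n. \<gamma>y (\<kappa> n)) \<longlonglongrightarrow> \<gamma>2"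
  proof -
    note xp = box_compl_pos_parts[OF l_range v_range l_less_v bx]
    note yp = box_compl_pos_parts[OF s_range r_range s_less_r by']
    have pos: "(\<lambda>n. \<chi> i. max 0 (w n $ i)) \<longlonglongrightarrow> (\<chi> i. max 0 (w0 $ i))"
      "(\<lambda>n. \<chi> i. max 0 (- w n $ i)) \<longlonglongrightarrow> (\<chi> i. max 0 (- w0 $ i))"
      if "w \<longlonglongrightarrow> w0" for w :: "nat \<Rightarrow> real ^ 'k" and w0
      by (rule vec_tendstoI, unfold vec_lambda_beta, intro tendsto_intros that)+
    show "(\<lambda>n. \<alpha>x (\<kappa> n)) \<longlonglongrightarrow> \<alpha>1" "(\<lambda>n. \<gamma>x (\<kappa> n)) \<longlonglongrightarrow> \<gamma>1"
      unfolding \<alpha>1_def \<gamma>1_def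
      by (rule Lim_transform_eventually[OF pos(2)[OF \<delta>1lim]], intro always_eventually allI xp(1)[symmetric],
          rule Lim_transform_eventually[OF pos(1)[OF \<delta>1lim]], intro always_eventually allI xp(2)[symmetric])
    show "(\<lambda>n. \<alpha>y (\<kappa> n)) \<longlonglongrightarrow> \<alpha>2" "(\<lambda>n. \<gamma>y (\<kappa> n)) \<longlonglongrightarrow> \<gamma>2"
      unfolding \<alpha>2_def \<gamma>2_def
      by (rule Lim_transform_eventually[OF pos(2)[OF \<delta>2lim]], intro always_eventually allI yp(1)[symmetric],
          rule Lim_transform_eventually[OF pos(1)[OF \<delta>2lim]], intro always_eventually allI yp(2)[symmetric])
  qed
  have \<delta>: "\<gamma>1 - \<alpha>1 = \<delta>1" "\<gamma>2 - \<alpha>2 = \<delta>2"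
    by (auto simp: vec_eq_iff \<alpha>1_def \<gamma>1_def \<alpha>2_def \<gamma>2_def max_def)
  have "kkt_solution xs ys ls \<mu> \<alpha>1 \<gamma>1 \<alpha>2 \<gamma>2"
    unfolding kkt_solution_def
  proof (intro conjI)
    have "vjoin (transpose E *v \<mu> + transpose C *v (\<gamma>1 - \<alpha>1)) (transpose F *v \<mu> + transpose D *v (\<gamma>2 - \<alpha>2))
        + vjoin (lagr_grad_x xs ys ls) (lagr_grad_y xs ys ls) = 0"
      unfolding \<delta> transpose_constraint_matrix_mult[symmetric] ms_eq[symmetric] Tms by simp
    then have "transpose E *v \<mu> + transpose C *v (\<gamma>1 - \<alpha>1) + lagr_grad_x xs ys ls = 0"
       "transpose F *v \<mu> + transpose D *v (\<gamma>2 - \<alpha>2) + lagr_grad_y xs ys ls = 0"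
      by (simp_all add: vjoin_add)
    \<comment> \<open>The residual vanishes at the limit, so the penalty part of the gradient of the
      augmented Lagrangian disappears and the ordinary KKT equations remain.\<close>
    then show "grad f xs - transpose A *v ls + transpose E *v \<mu> + transpose C *v (\<gamma>1 - \<alpha>1) = 0"
      "grad \<theta> ys - transpose B *v ls + transpose F *v \<mu> + transpose D *v (\<gamma>2 - \<alpha>2) = 0"
      by (simp_all add: lagr_grad_x_def lagr_grad_y_def feas_eq add_ac)
    show "A *v xs + B *v ys - b = 0" using feas_eq by (simp add: res_def)
    show "compl \<mu> (d - E *v xs - F *v ys)"
      unfolding compl_real_iff
    proof (intro allI conjI)
      fix i
      have mi: "(\<lambda>n. \<mu>x (\<kappa> n) $ i) \<longlonglongrightarrow> \<mu> $ i" using \<mu>lim by (rule tendsto_vec_nth)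
      show "0 \<le> \<mu> $ i" by (rule LIMSEQ_le_const[OF mi]) (use trial_parts(3) in blast)
      show "0 \<le> (d - E *v xs - F *v ys) $ i" using hs[of i] by (simp add: hval_def)
      show "\<mu> $ i = 0 \<or> (d - E *v xs - F *v ys) $ i = 0"
      proof (cases "hval xs ys $ i = 0")
        case True then show ?thesis by (simp add: hval_def algebra_simps)
      next
        case False
        then have "(\<lambda>n. \<mu>x (\<kappa> n) $ i) \<longlonglongrightarrow> 0" using supp\<mu>i[of i] by (intro tendsto_eventually) simp
        then show ?thesis using mi LIMSEQ_unique by blast
      qed
    qed
    show "box_compl l C v xs \<alpha>1 \<gamma>1" by (rule box_compl_limit(2)[OF l_range v_range bx tx lims(1,2)])
    show "box_compl s D r ys \<alpha>2 \<gamma>2" by (rule box_compl_limit(2)[OF s_range r_range by' ty lims(3,4)])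
  qed
  moreover have "(\<lambda>n. (\<mu>x (\<kappa> n), \<mu>y (\<kappa> n), \<alpha>x (\<kappa> n), \<gamma>x (\<kappa> n), \<alpha>y (\<kappa> n), \<gamma>y (\<kappa> n)))
      \<longlonglongrightarrow> (\<mu>, \<mu>, \<alpha>1, \<gamma>1, \<alpha>2, \<gamma>2)"
    by (intro tendsto_intros \<mu>lim \<mu>ylim lims)
  ultimately show ?thesis by blast
qed

lemma accumulation_points_kkt:
  assumes acc: "accumulation_point (\<lambda>k. (x k, y k, lam k)) (xs, ys, ls)"
    and rank: "full_row_rank_on constraint_matrix (active_set xs ys)"
  shows "\<exists>K \<mu> \<alpha>1 \<gamma>1 \<alpha>2 \<gamma>2. infinite K \<and>
     ((\<lambda>k. (\<mu>x k, \<mu>y k, \<alpha>x k, \<gamma>x k, \<alpha>y k, \<gamma>y k)) \<longlongrightarrow> (\<mu>, \<mu>, \<alpha>1, \<gamma>1, \<alpha>2, \<gamma>2))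
        (inf sequentially (principal K)) \<and>
     kkt_solution xs ys ls \<mu> \<alpha>1 \<gamma>1 \<alpha>2 \<gamma>2"
proof -
  obtain \<kappa> where \<kappa>: "strict_mono \<kappa>" and w: "(\<lambda>n. (x (\<kappa> n), y (\<kappa> n), lam (\<kappa> n))) \<longlonglongrightarrow> (xs, ys, ls)"
    using acc by (auto simp: accumulation_point_def o_def)
  have lim: "(\<lambda>n. x (\<kappa> n)) \<longlonglongrightarrow> xs" "(\<lambda>n. y (\<kappa> n)) \<longlonglongrightarrow> ys" "(\<lambda>n. lam (\<kappa> n)) \<longlonglongrightarrow> ls"
    using tendsto_fst[OF w] tendsto_fst[OF tendsto_snd[OF w]] tendsto_snd[OF tendsto_snd[OF w]] by simp_all
  obtain \<phi> where \<phi>: "strict_mono \<phi>" and dir: "(\<lambda>n. p (\<kappa> (\<phi> n))) \<longlonglongrightarrow> 0" "(\<lambda>n. q (\<kappa> (\<phi> n))) \<longlonglongrightarrow> 0"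
    using directions_vanish_along_subsequence[OF \<kappa> lim] .
  have \<psi>: "strict_mono (\<lambda>n. \<kappa> (\<phi> n))" using strict_mono_o[OF \<kappa> \<phi>] by (simp add: o_def)
  have lim': "(\<lambda>n. x (\<kappa> (\<phi> n))) \<longlonglongrightarrow> xs" "(\<lambda>n. y (\<kappa> (\<phi> n))) \<longlonglongrightarrow> ys" "(\<lambda>n. lam (\<kappa> (\<phi> n))) \<longlonglongrightarrow> ls"
    using LIMSEQ_subseq_LIMSEQ[OF lim(1) \<phi>] LIMSEQ_subseq_LIMSEQ[OF lim(2) \<phi>] LIMSEQ_subseq_LIMSEQ[OF lim(3) \<phi>]
    by (simp_all add: o_def)
  obtain \<mu> \<alpha>1 \<gamma>1 \<alpha>2 \<gamma>2 where
      ml: "(\<lambda>n. (\<mu>x (\<kappa> (\<phi> n)), \<mu>y (\<kappa> (\<phi> n)), \<alpha>x (\<kappa> (\<phi> n)), \<gamma>x (\<kappa> (\<phi> n)), \<alpha>y (\<kappa> (\<phi> n)), \<gamma>y (\<kappa> (\<phi> n))))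
        \<longlonglongrightarrow> (\<mu>, \<mu>, \<alpha>1, \<gamma>1, \<alpha>2, \<gamma>2)"
    and kkt: "kkt_solution xs ys ls \<mu> \<alpha>1 \<gamma>1 \<alpha>2 \<gamma>2"
    using multipliers_converge[OF \<psi> lim' dir rank] by blast
  have inf: "infinite (range (\<lambda>n. \<kappa> (\<phi> n)))"
    using \<psi> by (simp add: range_inj_infinite strict_mono_imp_inj_on)
  show ?thesis
    by (intro exI conjI, rule inf, rule tendsto_along_range[OF \<psi> ml], rule kkt)
qed

end

section \<open>Application to a run of the algorithm\<close>

theorem theorem3p1:
  fixes f :: "real ^ 'n1 \<Rightarrow> real" and \<theta> :: "real ^ 'n2 \<Rightarrow> real"
    and A :: "real ^ 'n1 ^ 'm1" and B :: "real ^ 'n2 ^ 'm1" and b :: "real ^ 'm1"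
    and E :: "real ^ 'n1 ^ 'm2" and F :: "real ^ 'n2 ^ 'm2" and d :: "real ^ 'm2"
    and C :: "real ^ 'n1 ^ 'l1" and D :: "real ^ 'n2 ^ 'l2"
    and l v :: "ereal ^ 'l1" and s r :: "ereal ^ 'l2"
    and \<rho> \<sigma> \<tau>1 \<tau>2 c \<beta> \<xi> M M1 M2 \<eta> :: real
    and x :: "nat \<Rightarrow> real ^ 'n1" and y :: "nat \<Rightarrow> real ^ 'n2" and lam :: "nat \<Rightarrow> real ^ 'm1"
    and Hx :: "nat \<Rightarrow> real ^ 'n1 ^ 'n1" and Hy :: "nat \<Rightarrow> real ^ 'n2 ^ 'n2"
    and \<mu>x \<mu>y :: "nat \<Rightarrow> real ^ 'm2"
    and \<alpha>x \<gamma>x :: "nat \<Rightarrow> real ^ 'l1" and \<alpha>y \<gamma>y :: "nat \<Rightarrow> real ^ 'l2"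
  assumes setting: "pfd_sqo f \<theta> l v s r \<rho> \<sigma> \<tau>1 \<tau>2 c \<beta> \<xi> M M1 M2"
    and run: "pfd_sqo.infinite_run f \<theta> A B b E F d C D l v s r \<rho> \<sigma> \<tau>1 \<tau>2 c \<beta> \<xi> M M1 M2
                x y lam Hx Hy \<mu>x \<mu>y \<alpha>x \<gamma>x \<alpha>y \<gamma>y"
    and "\<eta> > 0"
    and "\<And>k. loewner_ge (pfd_sqo.calHu A B \<beta> (Hx k) (Hy k)) (\<eta> *\<^sub>R mat 1)"
    and "\<And>k. loewner_ge (pfd_sqo.hatHu A B \<beta> (Hx k) (Hy k)) (\<eta> *\<^sub>R mat 1)"
    and "\<And>K. infinite K \<Longrightarrow> bounded ((\<lambda>k. (x k, y k, lam k)) ` K) \<Longrightarrow>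
           bounded ((\<lambda>k. pfd_sqo.calHu A B \<beta> (Hx k) (Hy k)) ` K) \<and>
           bounded ((\<lambda>k. pfd_sqo.hatHu A B \<beta> (Hx k) (Hy k)) ` K)"
    and "\<And>xs ys ls. accumulation_point (\<lambda>k. (x k, y k, lam k)) (xs, ys, ls) \<Longrightarrow>
           full_row_rank_on (two_block_problem.constraint_matrix E F C D)
             (two_block_problem.active_set E F d C D l v s r xs ys)"
  shows "\<forall>xs ys ls. accumulation_point (\<lambda>k. (x k, y k, lam k)) (xs, ys, ls) \<longrightarrow>
           (\<exists>K \<mu>s \<alpha>xs \<gamma>xs \<alpha>ys \<gamma>ys. infinite K \<and>
             ((\<lambda>k. (\<mu>x k, \<mu>y k, \<alpha>x k, \<gamma>x k, \<alpha>y k, \<gamma>y k))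
                \<longlongrightarrow> (\<mu>s, \<mu>s, \<alpha>xs, \<gamma>xs, \<alpha>ys, \<gamma>ys)) (inf sequentially (principal K)) \<and>
             two_block_problem.kkt_solution f \<theta> A B b E F d C D l v s r
               xs ys ls \<mu>s \<alpha>xs \<gamma>xs \<alpha>ys \<gamma>ys)"
proof (intro allI impI)
  fix xs ys ls
  assume acc: "accumulation_point (\<lambda>k. (x k, y k, lam k)) (xs, ys, ls)"
  interpret pfd_sqo f \<theta> A B b E F d C D l v s r \<rho> \<sigma> \<tau>1 \<tau>2 c \<beta> \<xi> M M1 M2
    by (rule setting)
  have adm: "admissible (Hx k) (Hy k)"
    and it: "iteration (x k) (y k) (lam k) (Hx k) (Hy k) (\<mu>x k) (\<mu>y k) (\<alpha>x k) (\<gamma>x k) (\<alpha>y k) (\<gamma>y k)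
            (x (Suc k)) (y (Suc k)) (lam (Suc k))" for k
    using run unfolding infinite_run_def by blast+
  \<comment> \<open>Feasibility of every iterate comes first: the descent property of a step
    presupposes that the current point is feasible for its subproblem.\<close>
  have feas: "(x k, y k) \<in> F_plus" for k
  proof (induction k)
    case 0
    then show ?case using run unfolding infinite_run_def by blast
  next
    case (Suc k)
    then show ?case using iteration_facts(1)[OF adm _ it] by blast
  qed
  obtain Hu p q cmax t where steps: "\<And>k. Hu k \<in> {calHu (Hx k) (Hy k), hatHu (Hx k) (Hy k)} \<and> 1 / 2 \<le> cmax k \<and>
      trial_step (x k) (y k) (lam k) (Hu k) (p k) (q k) (\<mu>x k) (\<mu>y k) (\<alpha>x k) (\<gamma>x k) (\<alpha>y k) (\<gamma>y k) \<and>
      line_search (cmax k) (Hu k) (x k) (y k) (lam k) (p k) (q k) (t k) \<and>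
      x (Suc k) = x k + t k *\<^sub>R p k \<and> y (Suc k) = y k + t k *\<^sub>R q k \<and>
      lam (Suc k) = lam k + \<xi> *\<^sub>R res (x (Suc k)) (y (Suc k))"
    using iteration_facts(2)[OF adm feas it] by metis
  interpret pfd_sqo_steps f \<theta> A B b E F d C D l v s r \<rho> \<sigma> \<tau>1 \<tau>2 c \<beta> \<xi> M M1 M2
    x p y q lam Hu cmax t \<eta> \<mu>x \<mu>y \<alpha>x \<gamma>x \<alpha>y \<gamma>y
  proof unfold_locales
    fix k
    show "\<eta> * (norm z)\<^sup>2 \<le> sq_norm (Hu k) z" for z
      using steps[of k] loewner_ge_scaled_id[OF assms(4)] loewner_ge_scaled_id[OF assms(5)] by auto
    show "0 < \<eta>" by (rule assms(3))
    show "(x k, y k) \<in> F_plus" by (rule feas)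
  next
    fix K :: "nat set"
    assume "infinite K" "bounded ((\<lambda>k. (x k, y k, lam k)) ` K)"
    \<comment> \<open>Each \<open>Hu k\<close> is one of the two matrices of iteration
      \<open>k\<close>, so bounding the union of both families covers any pattern of
      choices.\<close>
    then have "bounded ((\<lambda>k. calHu (Hx k) (Hy k)) ` K \<union> (\<lambda>k. hatHu (Hx k) (Hy k)) ` K)"
      using assms(6) by simp
    then show "bounded (Hu ` K)"
      by (rule bounded_subset) (use steps in blast)
  qed (use steps in blast)+
  show "\<exists>K \<mu>s \<alpha>xs \<gamma>xs \<alpha>ys \<gamma>ys. infinite K \<and>
             ((\<lambda>k. (\<mu>x k, \<mu>y k, \<alpha>x k, \<gamma>x k, \<alpha>y k, \<gamma>y k))
                \<longlongrightarrow> (\<mu>s, \<mu>s, \<alpha>xs, \<gamma>xs, \<alpha>ys, \<gamma>ys)) (inf sequentially (principal K)) \<and>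
             kkt_solution xs ys ls \<mu>s \<alpha>xs \<gamma>xs \<alpha>ys \<gamma>ys"
    by (rule accumulation_points_kkt[OF acc assms(7)[OF acc]])
qed

end
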